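(* Let $q\ge1$ and let $\{M_1(t)\}_{t\ge0},\dots,\{M_q(t)\}_{t\ge0}$ be independent generalized counting processes, where $M_i$ has positive rates $\lambda_{i1},\dots,\lambda_{ik_i}$, and let $\{M_0(t)\}_{t\ge0}$ be a generalized counting process with positive rates $\mu_1,\dots,\mu_{k_0}$, independent of $(M_1,\dots,M_q)$. The Lévy measure of the Lévy process $\bar{\mathcal M}(t)=(M_1(M_0(t)),\dots,M_q(M_0(t)))$ is given, for Borel sets $A_1,\dots,A_q\subseteq\mathbb{R}$, by $$\hat\Pi_{\bar{\mathcal M}}(A_1\times A_2\times\dots\times A_q)=\sum_{j_0=1}^{k_0}\mu_{j_0}\sum_{\bar n\succ\bar0}\ \sum_{\substack{\Omega(k_i,n_i)\\ i=1,2,\dots,q}}\ \prod_{i=1}^{q}\Big(\prod_{j_i=1}^{k_i}\frac{(j_0\lambda_{ij_i})^{n_{ij_i}}}{n_{ij_i}!}e^{-j_0\lambda_{ij_i}}\Big)\mathbb{I}_{\{n_i\in A_i\}}.$$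
   Context: A generalized counting process (GCP) $\{M(t)\}_{t\ge0}$ with positive rates $\lambda_1,\dots,\lambda_k$ is a right-continuous $\mathbb{N}_0$-valued process with $M(0)=0$ and stationary independent increments, whose probability generating function is $\mathbb{E}(u^{M(t)})=\exp\big(-t\sum_{j=1}^{k}\lambda_j(1-u^j)\big)$, $|u|\le1$. The process $\bar{\mathcal M}$ is called the multivariate IGCP; it is a Lévy process in $\mathbb{R}^q$. The relation $\bar n\succ\bar0$ for $\bar n=(n_1,\dots,n_q)$ with integer entries means $n_i\ge0$ for all $i$ and $\bar n\ne(0,\dots,0)$. $\Omega(k_i,n_i)=\{(n_{i1},\dots,n_{ik_i})\in\mathbb{N}_0^{k_i}:\sum_{j_i=1}^{k_i}j_in_{ij_i}=n_i\}$, and the sum is over all choices of one element from each $\Omega(k_i,n_i)$. A Lévy measure gives no mass to the origin. $\mathbb{I}$ denotes an indicator. *)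

theory Defs
  imports "HOL-Probability.Probability"
begin

text \<open>Stochastic processes are functions of a time \<open>t :: real\<close>, of which only the
  restriction to \<open>t \<ge> 0\<close> is relevant, and of a sample point.\<close>

definition independent_increments ::
    "'w measure \<Rightarrow> (real \<Rightarrow> 'w \<Rightarrow> 'b::{second_countable_topology, real_normed_vector}) \<Rightarrow> bool" where
  "independent_increments P X \<longleftrightarrow>
     (\<forall>(n::nat) (t::nat \<Rightarrow> real). 0 \<le> t 0 \<and> (\<forall>i<n. t i \<le> t (Suc i)) \<longrightarrow>
        prob_space.indep_vars P (\<lambda>_. borel) (\<lambda>i \<omega>. X (t (Suc i)) \<omega> - X (t i) \<omega>) {..<n})"

definition stationary_increments ::
    "'w measure \<Rightarrow> (real \<Rightarrow> 'w \<Rightarrow> 'b::{second_countable_topology, real_normed_vector}) \<Rightarrow> bool" where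
  "stationary_increments P X \<longleftrightarrow>
     (\<forall>s\<ge>0. \<forall>t\<ge>0. distr P borel (\<lambda>\<omega>. X (s + t) \<omega> - X s \<omega>) = distr P borel (\<lambda>\<omega>. X t \<omega> - X 0 \<omega>))"

definition generalized_counting_process ::
    "'w measure \<Rightarrow> nat \<Rightarrow> (nat \<Rightarrow> real) \<Rightarrow> (real \<Rightarrow> 'w \<Rightarrow> nat) \<Rightarrow> bool" where
  "generalized_counting_process P k rate N \<longleftrightarrow>
     1 \<le> k \<and> (\<forall>j\<in>{1..k}. 0 < rate j) \<and>
     (\<forall>t\<ge>0. N t \<in> measurable P (count_space UNIV)) \<and>
     (AE \<omega> in P. N 0 \<omega> = 0) \<and>
     (AE \<omega> in P. \<forall>t\<ge>0. continuous (at_right t) (\<lambda>s. real (N s \<omega>))) \<and>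
     independent_increments P (\<lambda>t \<omega>. real (N t \<omega>)) \<and>
     stationary_increments P (\<lambda>t \<omega>. real (N t \<omega>)) \<and>
     (\<forall>t\<ge>0. \<forall>u::real. \<bar>u\<bar> \<le> 1 \<longrightarrow>
        (LINT \<omega>|P. u ^ N t \<omega>) = exp (- t * (\<Sum>j=1..k. rate j * (1 - u ^ j))))"

text \<open>The space of paths of an \<open>\<nat>\<close>-valued process, with the product \<open>\<sigma>\<close>-algebra:
  independence of processes is independence of their paths as elements of this space.\<close>

definition path_space :: "(real \<Rightarrow> nat) measure" where
  "path_space = PiM {0..} (\<lambda>_. count_space UNIV)"

definition sample_path :: "(real \<Rightarrow> 'w \<Rightarrow> nat) \<Rightarrow> 'w \<Rightarrow> real \<Rightarrow> nat" where
  "sample_path N \<omega> = (\<lambda>t\<in>{0..}. N t \<omega>)"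

definition levy_process ::
    "'w measure \<Rightarrow> (real \<Rightarrow> 'w \<Rightarrow> 'b::{second_countable_topology, real_normed_vector}) \<Rightarrow> bool" where
  "levy_process P X \<longleftrightarrow>
     (\<forall>t\<ge>0. X t \<in> borel_measurable P) \<and>
     (AE \<omega> in P. X 0 \<omega> = 0) \<and>
     independent_increments P X \<and> stationary_increments P X \<and>
     (AE \<omega> in P. \<forall>t\<ge>0. continuous (at_right t) (\<lambda>s. X s \<omega>)) \<and>
     (AE \<omega> in P. \<forall>t>0. \<exists>l. ((\<lambda>s. X s \<omega>) \<longlongrightarrow> l) (at_left t))"

definition levy_khintchine_exponent ::
    "real ^ 'q \<Rightarrow> real ^ 'q ^ 'q \<Rightarrow> (real ^ 'q) measure \<Rightarrow> real ^ 'q \<Rightarrow> complex" where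
  "levy_khintchine_exponent b A \<nu> u =
     \<i> * of_real (b \<bullet> u) - of_real ((u \<bullet> (A *v u)) / 2) +
     (LINT x|\<nu>. cis (u \<bullet> x) - 1 - \<i> * of_real ((u \<bullet> x) * indicator (cball 0 1) x))"

text \<open>\<open>\<nu>\<close> is the Levy measure of the Levy process \<open>X\<close>: it is the third component of a
  generating triplet in the Levy--Khintchine representation of \<open>X\<close>.\<close>

definition is_levy_measure ::
    "'w measure \<Rightarrow> (real \<Rightarrow> 'w \<Rightarrow> real ^ 'q) \<Rightarrow> (real ^ 'q) measure \<Rightarrow> bool" where
  "is_levy_measure P X \<nu> \<longleftrightarrow>
     levy_process P X \<and>
     sets \<nu> = sets borel \<and> emeasure \<nu> {0} = 0 \<and>
     (\<integral>\<^sup>+ x. ennreal (min 1 ((norm x)\<^sup>2)) \<partial>\<nu>) < \<infinity> \<and>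
     (\<exists>b A. transpose A = A \<and> (\<forall>u. 0 \<le> u \<bullet> (A *v u)) \<and>
        (\<forall>t\<ge>0. \<forall>u. (LINT \<omega>|P. cis (u \<bullet> X t \<omega>)) =
                      exp (of_real t * levy_khintchine_exponent b A \<nu> u)))"

text \<open>The multivariate IGCP; \<open>M\<^sub>0\<close> is \<open>\<nat>\<close>-valued and serves as a random time.\<close>

definition multivariate_igcp ::
    "(real \<Rightarrow> 'w \<Rightarrow> nat) \<Rightarrow> ('q::finite \<Rightarrow> real \<Rightarrow> 'w \<Rightarrow> nat) \<Rightarrow> real \<Rightarrow> 'w \<Rightarrow> real ^ 'q" where
  "multivariate_igcp M0 M t \<omega> = (\<chi> i. real (M i (real (M0 t \<omega>)) \<omega>))"

text \<open>Tuples \<open>(m\<^sub>1, \<dots>, m\<^sub>k)\<close> are extensional functions on \<open>{1..k}\<close>.\<close>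

definition Omega :: "nat \<Rightarrow> nat \<Rightarrow> (nat \<Rightarrow> nat) set" where
  "Omega k n = {m \<in> {1..k} \<rightarrow>\<^sub>E UNIV. (\<Sum>j=1..k. j * m j) = n}"

lemma finite_Omega: "finite (Omega k n)"
proof (rule finite_subset)
  show "Omega k n \<subseteq> {1..k} \<rightarrow>\<^sub>E {..n}"
  proof
    fix m assume m: "m \<in> Omega k n"
    have "m j \<le> n" if "j \<in> {1..k}" for j
    proof -
      have "m j \<le> j * m j" using that by simp
      also have "\<dots> \<le> (\<Sum>j=1..k. j * m j)"
        by (rule member_le_sum[OF that]) auto
      finally show ?thesis using m by (simp add: Omega_def)
    qed
    with m show "m \<in> {1..k} \<rightarrow>\<^sub>E {..n}" by (auto simp: Omega_def PiE_iff)
  qed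
  show "finite ({1..k} \<rightarrow>\<^sub>E {..n})" by (intro finite_PiE) auto
qed

end

theory Submission
  imports Defs "HOL-Complex_Analysis.Cauchy_Integral_Formula"
begin

text \<open>
  A generalized counting process at time \<open>t\<close> has the probability generating function of
  \<open>\<Sum>\<^sub>j j N\<^sub>j\<close> with independent Poisson variables \<open>N\<^sub>j\<close> of mean \<open>t \<lambda>\<^sub>j\<close>, hence this law.  Conditioning on
  the path of \<open>M\<^sub>0\<close> shows that the subordinated process is a Levy process and that its
  characteristic function at time \<open>t\<close> is the generating function of \<open>M\<^sub>0(t)\<close> evaluated at the
  characteristic function \<open>z\<close> of \<open>(M\<^sub>1(1), \<dots>, M\<^sub>q(1))\<close>, that is
  \<open>exp (t \<Sum>\<^sub>j \<mu>\<^sub>j (z\<^sup>j - 1))\<close>.  Since \<open>z\<^sup>j\<close> is the characteristic function of \<open>(M\<^sub>1(j), \<dots>, M\<^sub>q(j))\<close>, this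
  is a compound Poisson process whose Levy measure is the \<open>\<mu>\<^sub>j\<close>-weighted sum of the laws of these
  vectors, without their mass at the origin.

  For uniqueness, the exponent of the process is \<open>2\<pi>\<close>-periodic in every coordinate.  Taking real parts
  at the periods forces any Levy measure to live on the integer lattice and the Gaussian part to
  vanish; the measure is then finite, and its point masses are Fourier coefficients of the exponent.
\<close>

section \<open>Generalized counting processes\<close>

lemma integrable_pmf_bounded:
  fixes f :: "'a \<Rightarrow> 'b::{banach, second_countable_topology}"
  assumes "\<And>x. norm (f x) \<le> B"
  shows "integrable (measure_pmf p) f"
  by (intro measure_pmf.integrable_const_bound[where B = B]) (auto simp: assms)

text \<open>The coordinates under \<open>Pi_pmf\<close> are independent, so the expectation
  factorizes; boundedness supplies integrability, and the general field admits the complex values of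
  characteristic functions.\<close>

lemma expectation_prod_Pi_pmf_bounded:
  fixes f :: "'i \<Rightarrow> 'a \<Rightarrow> 'b::{real_normed_field, banach, second_countable_topology}"
  assumes "finite I" and "\<And>i x. i \<in> I \<Longrightarrow> norm (f i x) \<le> B i"
  shows "measure_pmf.expectation (Pi_pmf I dflt p) (\<lambda>y. \<Prod>i\<in>I. f i (y i)) =
           (\<Prod>i\<in>I. measure_pmf.expectation (p i) (f i))"
proof -
  let ?P = "measure_pmf (Pi_pmf I dflt p)"
  have "prob_space.indep_vars ?P (\<lambda>_. borel) (\<lambda>i y. f i (y i)) I"
    using prob_space.indep_vars_compose2[OF measure_pmf.prob_space_axioms
        indep_vars_Pi_pmf[OF assms(1)], where Y = f and N = "\<lambda>_. borel"] by simp
  then have "measure_pmf.expectation (Pi_pmf I dflt p) (\<lambda>y. \<Prod>i\<in>I. f i (y i)) =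
      (\<Prod>i\<in>I. \<integral>y. f i (y i) \<partial>?P)"
    by (intro prob_space.indep_vars_lebesgue_integral measure_pmf.prob_space_axioms assms(1))
       (auto intro!: integrable_pmf_bounded[where B = "B _"] assms(2))
  also have "\<dots> = (\<Prod>i\<in>I. measure_pmf.expectation (p i) (f i))"
  proof (intro prod.cong refl)
    fix i assume i: "i \<in> I"
    have "(\<integral>y. f i (y i) \<partial>?P) = (\<integral>x. f i x \<partial>measure_pmf (map_pmf (\<lambda>y. y i) (Pi_pmf I dflt p)))"
      by (simp add: integral_map_pmf)
    then show "(\<integral>y. f i (y i) \<partial>?P) = measure_pmf.expectation (p i) (f i)"
      using i by (simp add: Pi_pmf_component assms(1))
  qed
  finally show ?thesis .
qed

text \<open>Connects expectations with power series. The value type is general because real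
  arguments serve to identify laws and complex ones to compute characteristic functions.\<close>

lemma pgf_sums:
  fixes p :: "nat pmf" and z :: "'b::{real_normed_field, banach, second_countable_topology}"
  assumes "norm z \<le> 1"
  shows "(\<lambda>n. of_real (pmf p n) * z ^ n) sums measure_pmf.expectation p (\<lambda>n. z ^ n)"
proof -
  have int: "integrable (measure_pmf p) (\<lambda>n. z ^ n)"
    by (rule integrable_pmf_bounded[where B = 1]) (simp add: norm_power power_le_one assms)
  then have "integrable (count_space UNIV) (\<lambda>n. pmf p n *\<^sub>R z ^ n)"
    by (simp add: measure_pmf_eq_density integrable_density)
  then have "(\<lambda>n. pmf p n *\<^sub>R z ^ n) sums (\<integral>n. pmf p n *\<^sub>R z ^ n \<partial>count_space UNIV)"
    by (rule sums_integral_count_space_nat)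
  then show ?thesis
    by (simp add: measure_pmf_eq_density integral_density scaleR_conv_of_real)
qed

text \<open>The difference of the two generating functions is a power series that vanishes for all
  real arguments of modulus below 1, so its coefficients vanish.\<close>

lemma pmf_eqI_pgf:
  fixes p q :: "nat pmf"
  assumes "\<And>u::real. \<bar>u\<bar> \<le> 1 \<Longrightarrow>
    measure_pmf.expectation p (\<lambda>n. u ^ n) = measure_pmf.expectation q (\<lambda>n. u ^ n)"
  shows "p = q"
proof (rule pmf_eqI, rule ccontr)
  fix m assume m: "pmf p m \<noteq> pmf q m"
  define a where "a n = pmf p n - pmf q n" for n
  have sm: "(\<lambda>n. a n * (u - 0) ^ n) sums 0" if "norm (u - 0) < 1" for u :: real
    using sums_diff[OF pgf_sums[of u p] pgf_sums[of u q]] assms[of u] that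
    by (simp add: a_def algebra_simps)
  have "a 0 = 0"
    using sums_unique[OF sm[of 0]] by (simp add: powser_zero)
  with m have "m > 0" by (cases m) (auto simp: a_def)
  \<comment> \<open>Here \<open>powser_0_nonzero\<close> is applied with the zero function as the
    sum: a nonzero coefficient of positive index would make it nonzero on a punctured neighbourhood
    of 0. Index 0 was excluded by evaluating at 0.\<close>
  obtain s :: real where "0 < s" "\<And>z::real. z \<in> cball 0 s - {0} \<Longrightarrow> (0::real) \<noteq> 0"
    by (rule powser_0_nonzero[of 1 0 a "\<lambda>_. 0" m])
       (use sm m \<open>m > 0\<close> in \<open>auto simp: a_def\<close>)
  from this(2)[of s] this(1) show False by auto
qed

lemma pgf_poisson:
  fixes z :: "'b::{real_normed_field, banach, second_countable_topology}"
  assumes "0 < r" "norm z \<le> 1"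
  shows "measure_pmf.expectation (poisson_pmf r) (\<lambda>n. z ^ n) = exp (of_real r * (z - 1))"
proof -
  have "(\<lambda>n. of_real (exp (- r)) * ((of_real r * z) ^ n /\<^sub>R fact n)) sums
      (of_real (exp (- r)) * exp (of_real r * z))"
    by (intro sums_mult exp_converges)
  moreover have "of_real (exp (- r)) * ((of_real r * z) ^ n /\<^sub>R fact n) =
      of_real (pmf (poisson_pmf r) n) * z ^ n" for n
    by (simp add: assms scaleR_conv_of_real power_mult_distrib field_simps)
  ultimately have "measure_pmf.expectation (poisson_pmf r) (\<lambda>n. z ^ n) =
      of_real (exp (- r)) * exp (of_real r * z)"
    using pgf_sums[OF assms(2), of "poisson_pmf r"] by (simp add: sums_unique2)
  also have "\<dots> = exp (of_real r * (z - 1))"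
    by (simp add: algebra_simps flip: exp_of_real exp_add)
  finally show ?thesis .
qed

text \<open>The default value \<open>undefined\<close> makes the sampled tuples extensional, as in \<open>Omega\<close>.\<close>

definition gcp_pmf :: "nat \<Rightarrow> (nat \<Rightarrow> real) \<Rightarrow> real \<Rightarrow> nat pmf" where
  "gcp_pmf k rate t =
     map_pmf (\<lambda>m. \<Sum>j=1..k. j * m j) (Pi_pmf {1..k} undefined (\<lambda>j. poisson_pmf (t * rate j)))"

lemma pgf_gcp_pmf:
  fixes z :: "'b::{real_normed_field, banach, second_countable_topology}"
  assumes "0 < t" "\<And>j. j \<in> {1..k} \<Longrightarrow> 0 < rate j" "norm z \<le> 1"
  shows "measure_pmf.expectation (gcp_pmf k rate t) (\<lambda>n. z ^ n) =
    exp (- of_real t * (\<Sum>j=1..k. of_real (rate j) * (1 - z ^ j)))"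
proof -
  have zj: "norm (z ^ j) \<le> 1" for j
    by (simp add: norm_power power_le_one assms)
  have "measure_pmf.expectation (gcp_pmf k rate t) (\<lambda>n. z ^ n) =
      measure_pmf.expectation (Pi_pmf {1..k} undefined (\<lambda>j. poisson_pmf (t * rate j)))
        (\<lambda>m. \<Prod>j=1..k. (z ^ j) ^ m j)"
    by (simp add: gcp_pmf_def integral_map_pmf power_sum power_mult)
  also have "\<dots> = (\<Prod>j=1..k. measure_pmf.expectation (poisson_pmf (t * rate j)) (\<lambda>n. (z ^ j) ^ n))"
    by (rule expectation_prod_Pi_pmf_bounded[where B = "\<lambda>_. 1"])
       (auto simp: norm_power[of "z ^ _"] power_le_one zj)
  also have "\<dots> = (\<Prod>j=1..k. exp (of_real (t * rate j) * (z ^ j - 1)))"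
    by (intro prod.cong refl pgf_poisson zj mult_pos_pos assms)
  also have "\<dots> = exp (- of_real t * (\<Sum>j=1..k. of_real (rate j) * (1 - z ^ j)))"
    by (simp add: sum_distrib_left algebra_simps flip: exp_sum)
  finally show ?thesis .
qed

lemma pmf_gcp_pmf:
  assumes "0 < t" "\<And>j. j \<in> {1..k} \<Longrightarrow> 0 < rate j"
  shows "pmf (gcp_pmf k rate t) n =
    (\<Sum>m\<in>Omega k n. \<Prod>j=1..k. (t * rate j) ^ m j / fact (m j) * exp (- (t * rate j)))"
proof -
  let ?p = "Pi_pmf {1..k} undefined (\<lambda>j. poisson_pmf (t * rate j))"
  have "pmf (gcp_pmf k rate t) n = measure ?p ((\<lambda>m. \<Sum>j=1..k. j * m j) -` {n})"
    by (simp add: gcp_pmf_def pmf_map)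
  \<comment> \<open>Almost every sampled tuple takes the default value outside
    \<open>{1..k}\<close>, so up to a null set the fibre over \<open>n\<close> is the set
    \<open>Omega k n\<close> of extensional tuples, which is finite.\<close>
  also have "\<dots> = measure ?p (Omega k n)"
    using set_Pi_pmf_subset[of "{1..k}" undefined "\<lambda>j. poisson_pmf (t * rate j)"]
    by (intro measure_eq_AE AE_pmfI) (auto simp: Omega_def PiE_iff extensional_def)
  also have "\<dots> = (\<Sum>m\<in>Omega k n. pmf ?p m)"
    by (rule measure_measure_pmf_finite[OF finite_Omega])
  also have "\<dots> = (\<Sum>m\<in>Omega k n. \<Prod>j=1..k. (t * rate j) ^ m j / fact (m j) * exp (- (t * rate j)))"
    by (intro sum.cong refl, subst pmf_Pi')
       (auto simp: Omega_def PiE_iff extensional_def assms intro!: prod.cong)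
  finally show ?thesis .
qed

lemma gcp_measurable:
  "generalized_counting_process P k rate N \<Longrightarrow> 0 \<le> t \<Longrightarrow> N t \<in> measurable P (count_space UNIV)"
  by (simp add: generalized_counting_process_def)

lemma gcp_rate_pos:
  "generalized_counting_process P k rate N \<Longrightarrow> j \<in> {1..k} \<Longrightarrow> 0 < rate j"
  by (simp add: generalized_counting_process_def)

lemma gcp_AE_zero:
  "generalized_counting_process P k rate N \<Longrightarrow> AE \<omega> in P. N 0 \<omega> = 0"
  by (simp add: generalized_counting_process_def)

text \<open>The generating function is prescribed only at real arguments of modulus at most 1, but
  this determines a law on the naturals (\<open>pmf_eqI_pgf\<close>). Positivity of \<open>t\<close>
  keeps the Poisson parameters positive.\<close>

lemma (in prob_space) gcp_distr:
  assumes N: "generalized_counting_process M k rate N" and t: "0 < t"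
  shows "distr M (count_space UNIV) (N t) = measure_pmf (gcp_pmf k rate t)"
proof -
  have N_t: "N t \<in> measurable M (count_space UNIV)"
    using gcp_measurable[OF N] t by simp
  interpret D: prob_space "distr M (count_space UNIV) (N t)"
    by (rule prob_space_distr[OF N_t])
  define p where "p = Abs_pmf (distr M (count_space UNIV) (N t))"
  have p: "measure_pmf p = distr M (count_space UNIV) (N t)"
    unfolding p_def
    by (rule Abs_pmf_inverse) (auto simp: D.prob_space_axioms D.AE_support_countable intro!: AE_I2 exI[of _ "UNIV::nat set"])
  have "p = gcp_pmf k rate t"
  proof (rule pmf_eqI_pgf)
    fix u :: real assume u: "\<bar>u\<bar> \<le> 1"
    have "measure_pmf.expectation p (\<lambda>n. u ^ n) = (LINT \<omega>|M. u ^ N t \<omega>)"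
      unfolding p by (rule integral_distr[OF N_t]) simp
    also have "\<dots> = exp (- t * (\<Sum>j=1..k. rate j * (1 - u ^ j)))"
      using N t u by (simp add: generalized_counting_process_def)
    finally show "measure_pmf.expectation p (\<lambda>n. u ^ n) = measure_pmf.expectation (gcp_pmf k rate t) (\<lambda>n. u ^ n)"
      using pgf_gcp_pmf[OF t gcp_rate_pos[OF N], where z = u] u by simp
  qed
  then show ?thesis using p by simp
qed

text \<open>Extends the prescribed formula from real to complex arguments by way of the law. Time 0,
  where the Poisson parameters would degenerate, is handled separately with \<open>N 0 = 0\<close>
  almost surely.\<close>

lemma (in prob_space) gcp_pgf:
  fixes z :: "'b::{real_normed_field, banach, second_countable_topology}"
  assumes N: "generalized_counting_process M k rate N" and t: "0 \<le> t" and z: "norm z \<le> 1"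
  shows "(LINT \<omega>|M. z ^ N t \<omega>) = exp (- of_real t * (\<Sum>j=1..k. of_real (rate j) * (1 - z ^ j)))"
proof (cases "t = 0")
  case True
  have [measurable]: "N 0 \<in> measurable M (count_space UNIV)"
    using gcp_measurable[OF N] by simp
  have "(LINT \<omega>|M. z ^ N 0 \<omega>) = (LINT \<omega>|M. 1)"
    by (rule integral_cong_AE) (use gcp_AE_zero[OF N] in auto)
  with True show ?thesis by (simp add: prob_space)
next
  case False
  with t have "0 < t" by simp
  have "(LINT \<omega>|M. z ^ N t \<omega>) = integral\<^sup>L (distr M (count_space UNIV) (N t)) (\<lambda>n. z ^ n)"
    by (rule integral_distr[symmetric]) (use gcp_measurable[OF N t] in auto)
  also have "\<dots> = exp (- of_real t * (\<Sum>j=1..k. of_real (rate j) * (1 - z ^ j)))"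
    unfolding gcp_distr[OF N \<open>0 < t\<close>]
    by (rule pgf_gcp_pmf[OF \<open>0 < t\<close> gcp_rate_pos[OF N] z])
  finally show ?thesis .
qed

text \<open>Two naturals at distance less than 1 are equal, so convergence from the right becomes
  local constancy.\<close>

lemma eventually_const_at_right:
  fixes f :: "real \<Rightarrow> nat"
  assumes "continuous (at_right t) (\<lambda>s. real (f s))"
  shows "eventually (\<lambda>s. f s = f t) (at_right t)"
proof -
  have "((\<lambda>s. real (f s)) \<longlongrightarrow> real (f t)) (at_right t)"
    using assms by (simp add: continuous_within)
  from tendstoD[OF this zero_less_one] show ?thesis
    by eventually_elim (simp add: dist_real_def)
qed

section \<open>Independence, product laws and increments\<close>

context prob_space
begin

text \<open>Singletons determine a measure on a countable space, so factorization of the point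
  probabilities already identifies the joint law with the product of the marginals.\<close>

lemma indep_vars_countableI:
  fixes X :: "'i \<Rightarrow> 'a \<Rightarrow> 'b :: countable"
  assumes I: "finite I" and X [measurable]: "\<And>i. i \<in> I \<Longrightarrow> X i \<in> measurable M (count_space UNIV)"
    and prod: "\<And>x. prob {\<omega> \<in> space M. \<forall>i\<in>I. X i \<omega> = x i} = (\<Prod>i\<in>I. prob {\<omega> \<in> space M. X i \<omega> = x i})"
  shows "indep_vars (\<lambda>_. count_space UNIV) X I"
proof (cases "I = {}")
  case True
  then show ?thesis by (simp add: indep_vars_def indep_sets_def)
next
  case False
  let ?C = "\<lambda>_. count_space UNIV :: 'b measure"
  let ?D = "distr M (PiM I ?C) (\<lambda>\<omega>. \<lambda>i\<in>I. X i \<omega>)"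
  let ?E = "PiM I (\<lambda>i. distr M (count_space UNIV) (X i))"
  have meas: "(\<lambda>\<omega>. \<lambda>i\<in>I. X i \<omega>) \<in> measurable M (PiM I ?C)"
    by measurable
  have sets_E: "sets ?E = sets (PiM I ?C)" by (intro sets_PiM_cong) auto
  have single: "{f} \<in> sets (PiM I ?C)" if "f \<in> I \<rightarrow>\<^sub>E UNIV" for f
    using that I by (simp add: count_space_PiM_finite)
  have "?D = ?E"
  proof (rule measure_eqI_countable')
    fix f :: "'i \<Rightarrow> 'b" assume f: "f \<in> I \<rightarrow>\<^sub>E UNIV"
    \<comment> \<open>The interpretation asks for a sigma-finite measure at every index, while
      \<open>X i\<close> is known to be measurable only for \<open>i\<close> in \<open>I\<close>; a
      constant fills the other indices.\<close>
    interpret product_sigma_finite "\<lambda>i. distr M (count_space UNIV) (if i \<in> I then X i else (\<lambda>_. undefined))"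
      by (intro product_sigma_finite.intro prob_space_imp_sigma_finite prob_space_distr) auto
    have "?E = PiM I (\<lambda>i. distr M (count_space UNIV) (if i \<in> I then X i else (\<lambda>_. undefined)))"
      by (rule PiM_cong) auto
    moreover have "{f} = PiE I (\<lambda>i. {f i})"
      using f by (intro PiE_singleton[symmetric]) (auto simp: PiE_def)
    ultimately have "emeasure ?E {f} = (\<Prod>i\<in>I. emeasure (distr M (count_space UNIV) (X i)) {f i})"
      by (simp add: emeasure_PiM I cong: prod.cong)
    also have "\<dots> = (\<Prod>i\<in>I. ennreal (prob {\<omega> \<in> space M. X i \<omega> = f i}))"
      by (intro prod.cong refl)
         (auto simp: emeasure_distr emeasure_eq_measure intro!: arg_cong[where f = prob])
    also have "\<dots> = ennreal (prob {\<omega> \<in> space M. \<forall>i\<in>I. X i \<omega> = f i})"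
      by (simp add: prod prod_ennreal)
    also have "\<dots> = emeasure ?D {f}"
      using f single[OF f] meas
      by (auto simp: emeasure_distr emeasure_eq_measure PiE_iff extensional_def fun_eq_iff
          intro!: arg_cong[where f = prob])
    finally show "emeasure ?D {f} = emeasure ?E {f}" ..
  next
    show "countable (I \<rightarrow>\<^sub>E (UNIV :: 'b set))" using I by (intro countable_PiE) auto
  qed (use single sets_E in \<open>simp_all add: space_PiM\<close>)
  with indep_vars_iff_distr_eq_PiM'[OF False, where M' = ?C and X = X] X show ?thesis by simp
qed

lemma distr_countable_eqI:
  fixes X Y :: "'a \<Rightarrow> 'b :: countable"
  assumes [measurable]: "X \<in> measurable M (count_space UNIV)" "Y \<in> measurable M (count_space UNIV)"
    and eq: "\<And>x. prob {\<omega> \<in> space M. X \<omega> = x} = prob {\<omega> \<in> space M. Y \<omega> = x}"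
  shows "distr M (count_space UNIV) X = distr M (count_space UNIV) Y"
proof (rule measure_eqI_countable[of _ UNIV])
  fix x
  have "X -` {x} \<inter> space M = {\<omega> \<in> space M. X \<omega> = x}" "Y -` {x} \<inter> space M = {\<omega> \<in> space M. Y \<omega> = x}"
    by auto
  then show "emeasure (distr M (count_space UNIV) X) {x} = emeasure (distr M (count_space UNIV) Y) {x}"
    by (simp add: emeasure_distr emeasure_eq_measure eq)
qed auto

text \<open>The two maps may take values in different types, so their independence is expressed
  through the generated sigma-algebras; here it becomes a product law.\<close>

lemma distr_pair_vimage_algebra:
  assumes X: "X \<in> measurable M S" and Y: "Y \<in> measurable M T"
    and indep: "indep_set (sets (vimage_algebra (space M) X S)) (sets (vimage_algebra (space M) Y T))"
  shows "distr M S X \<Otimes>\<^sub>M distr M T Y = distr M (S \<Otimes>\<^sub>M T) (\<lambda>\<omega>. (X \<omega>, Y \<omega>))"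
proof (rule pair_measure_eqI)
  show "sigma_finite_measure (distr M S X)" "sigma_finite_measure (distr M T Y)"
    using X Y by (auto intro!: prob_space_imp_sigma_finite prob_space_distr)
  fix A B assume AB: "A \<in> sets (distr M S X)" "B \<in> sets (distr M T Y)"
  have "prob ((X -` A \<inter> space M) \<inter> (Y -` B \<inter> space M)) = prob (X -` A \<inter> space M) * prob (Y -` B \<inter> space M)"
    using AB by (intro indep_setD[OF indep] in_vimage_algebra) auto
  moreover have "(\<lambda>\<omega>. (X \<omega>, Y \<omega>)) -` (A \<times> B) \<inter> space M = (X -` A \<inter> space M) \<inter> (Y -` B \<inter> space M)"
    by auto
  ultimately show "emeasure (distr M S X) A * emeasure (distr M T Y) B =
      emeasure (distr M (S \<Otimes>\<^sub>M T) (\<lambda>\<omega>. (X \<omega>, Y \<omega>))) (A \<times> B)"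
    using AB X Y by (simp add: emeasure_distr emeasure_eq_measure ennreal_mult)
qed auto

text \<open>Fubini for the product law: the first argument is frozen and the second is replaced by
  an independent copy. This is the device for conditioning on the random time.\<close>

lemma indep_set_vimage_algebra_integral:
  fixes f :: "'b \<times> 'c \<Rightarrow> 'd :: {banach, second_countable_topology}"
  assumes X: "X \<in> measurable M S" and Y: "Y \<in> measurable M T"
    and indep: "indep_set (sets (vimage_algebra (space M) X S)) (sets (vimage_algebra (space M) Y T))"
    and f: "f \<in> borel_measurable (S \<Otimes>\<^sub>M T)"
    and bound: "\<And>z. norm (f z) \<le> B"
  shows "(LINT \<omega>|M. f (X \<omega>, Y \<omega>)) = (LINT \<omega>|M. LINT \<omega>'|M. f (X \<omega>, Y \<omega>'))"
proof -
  interpret X: prob_space "distr M S X" by (rule prob_space_distr[OF X])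
  interpret Y: prob_space "distr M T Y" by (rule prob_space_distr[OF Y])
  interpret XY: pair_prob_space "distr M S X" "distr M T Y" ..
  have sets_eq: "sets (distr M S X \<Otimes>\<^sub>M distr M T Y) = sets (S \<Otimes>\<^sub>M T)"
    by (intro sets_pair_measure_cong) auto
  have f': "f \<in> borel_measurable (distr M S X \<Otimes>\<^sub>M distr M T Y)"
    using f by (simp add: measurable_cong_sets[OF sets_eq refl])
  have f'': "f \<in> borel_measurable (S \<Otimes>\<^sub>M distr M T Y)"
    using f by (subst measurable_cong_sets[OF sets_pair_measure_cong refl, of S S _ T]) auto
  have "(LINT \<omega>|M. f (X \<omega>, Y \<omega>)) = integral\<^sup>L (distr M (S \<Otimes>\<^sub>M T) (\<lambda>\<omega>. (X \<omega>, Y \<omega>))) f"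
    by (rule integral_distr[symmetric]) (use X Y f in auto)
  also have "distr M (S \<Otimes>\<^sub>M T) (\<lambda>\<omega>. (X \<omega>, Y \<omega>)) = distr M S X \<Otimes>\<^sub>M distr M T Y"
    by (rule distr_pair_vimage_algebra[OF X Y indep, symmetric])
  also have "integral\<^sup>L (distr M S X \<Otimes>\<^sub>M distr M T Y) f = (LINT x|distr M S X. LINT y|distr M T Y. f (x, y))"
    by (rule XY.integral_fst'[symmetric], rule XY.P.integrable_const_bound[where B = B])
       (use f' bound in auto)
  also have "\<dots> = (LINT \<omega>|M. LINT y|distr M T Y. f (X \<omega>, y))"
    by (rule integral_distr[OF X]) (rule Y.borel_measurable_lebesgue_integral, simp add: f'')
  also have "\<dots> = (LINT \<omega>|M. LINT \<omega>'|M. f (X \<omega>, Y \<omega>'))"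
  proof (intro Bochner_Integration.integral_cong refl)
    fix \<omega> assume "\<omega> \<in> space M"
    then have "(\<lambda>y. f (X \<omega>, y)) \<in> borel_measurable T"
      using measurable_space[OF X] by (intro measurable_compose[OF measurable_Pair1' f]) auto
    then show "(LINT y|distr M T Y. f (X \<omega>, y)) = (LINT \<omega>'|M. f (X \<omega>, Y \<omega>'))"
      by (rule integral_distr[OF Y])
  qed
  finally show ?thesis .
qed

lemma gcp_increment_distr:
  assumes N: "generalized_counting_process M k rate N" and st: "0 \<le> s" "s \<le> t"
  shows "distr M borel (\<lambda>\<omega>. real (N t \<omega>) - real (N s \<omega>)) = distr M borel (\<lambda>\<omega>. real (N (t - s) \<omega>))"
proof -
  have [measurable]: "N r \<in> measurable M (count_space UNIV)" if "0 \<le> r" for r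
    using gcp_measurable[OF N that] .
  have "stationary_increments M (\<lambda>t \<omega>. real (N t \<omega>))"
    using N by (simp add: generalized_counting_process_def)
  then have "distr M borel (\<lambda>\<omega>. real (N (s + (t - s)) \<omega>) - real (N s \<omega>)) =
      distr M borel (\<lambda>\<omega>. real (N (t - s) \<omega>) - real (N 0 \<omega>))"
    unfolding stationary_increments_def using st by (meson diff_ge_0_iff_ge)
  also have "\<dots> = distr M borel (\<lambda>\<omega>. real (N (t - s) \<omega>))"
    using gcp_AE_zero[OF N] st by (intro distr_cong_AE) auto
  finally show ?thesis by simp
qed

lemma gcp_increment_prob:
  assumes N: "generalized_counting_process M k rate N" and st: "0 \<le> s" "s \<le> t"
  shows "prob {\<omega> \<in> space M. int (N t \<omega>) - int (N s \<omega>) = d} = prob {\<omega> \<in> space M. int (N (t - s) \<omega>) = d}"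
proof -
  have [measurable]: "N r \<in> measurable M (count_space UNIV)" if "0 \<le> r" for r
    using gcp_measurable[OF N that] .
  have "prob {\<omega> \<in> space M. int (N t \<omega>) - int (N s \<omega>) = d} =
      measure (distr M borel (\<lambda>\<omega>. real (N t \<omega>) - real (N s \<omega>))) {of_int d}"
    using st by (subst measure_distr) (auto intro!: arg_cong[where f = prob])
  also have "\<dots> = prob {\<omega> \<in> space M. int (N (t - s) \<omega>) = d}"
    unfolding gcp_increment_distr[OF assms]
    using st by (subst measure_distr) (auto intro!: arg_cong[where f = prob])
  finally show ?thesis .
qed

lemma gcp_AE_le:
  assumes N: "generalized_counting_process M k rate N" and st: "0 \<le> s" "s \<le> t"
  shows "AE \<omega> in M. N s \<omega> \<le> N t \<omega>"
proof -
  have [measurable]: "N r \<in> measurable M (count_space UNIV)" if "0 \<le> r" for r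
    using gcp_measurable[OF N that] .
  have "AE x in distr M borel (\<lambda>\<omega>. real (N t \<omega>) - real (N s \<omega>)). 0 \<le> x"
    unfolding gcp_increment_distr[OF assms] using st by (subst AE_distr_iff) auto
  then show ?thesis
    using st by (subst (asm) AE_distr_iff) auto
qed

text \<open>A single null set has to serve all pairs of times. Rational pairs are countably many,
  and right continuity carries the inequality over to real times.\<close>

lemma gcp_AE_mono:
  assumes N: "generalized_counting_process M k rate N"
  shows "AE \<omega> in M. \<forall>s t. 0 \<le> s \<longrightarrow> s \<le> t \<longrightarrow> N s \<omega> \<le> N t \<omega>"
proof -
  have "AE \<omega> in M. \<forall>p q :: rat. 0 \<le> (of_rat p :: real) \<longrightarrow> (of_rat p :: real) \<le> of_rat q \<longrightarrow>
      N (of_rat p) \<omega> \<le> N (of_rat q) \<omega>"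
    unfolding AE_all_countable using gcp_AE_le[OF N] by simp
  moreover have "AE \<omega> in M. \<forall>t\<ge>0. continuous (at_right t) (\<lambda>s. real (N s \<omega>))"
    using N by (simp add: generalized_counting_process_def)
  ultimately show ?thesis
  proof eventually_elim
    case (elim \<omega>)
    have right: "\<exists>b>t. \<forall>r. t < r \<and> r < b \<longrightarrow> N r \<omega> = N t \<omega>" if "0 \<le> t" for t
      using eventually_const_at_right[of t "\<lambda>s. N s \<omega>"] elim(2) that
      by (auto simp: eventually_at_right_field)
    show ?case
    proof (intro allI impI)
      fix s t :: real assume st: "0 \<le> s" "s \<le> t"
      show "N s \<omega> \<le> N t \<omega>"
      proof (cases "s = t")
        case False
        obtain a where a: "a > s" "\<And>r. s < r \<Longrightarrow> r < a \<Longrightarrow> N r \<omega> = N s \<omega>"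
          using right[of s] st by auto
        obtain b where b: "b > t" "\<And>r. t < r \<Longrightarrow> r < b \<Longrightarrow> N r \<omega> = N t \<omega>"
          using right[of t] st by auto
        \<comment> \<open>The rational \<open>p\<close> lies strictly between \<open>s\<close> and
          \<open>t\<close>, so close to \<open>s\<close> that the path has not moved yet;
          \<open>q\<close> plays the same role to the right of \<open>t\<close>.\<close>
        obtain p where p: "s < of_rat p" "of_rat p < min a t"
          using of_rat_dense[of s "min a t"] a st False by auto
        obtain q where q: "t < of_rat q" "of_rat q < b"
          using of_rat_dense[of t b] b by auto
        have "N (of_rat p) \<omega> \<le> N (of_rat q) \<omega>"
          using st p q by (intro elim(1)[rule_format]) linarith+
        then show ?thesis using a(2) b(2) p q by simp
      qed simp
    qed
  qed
qed

lemma gcp_increments_prob: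
  fixes a :: "nat \<Rightarrow> real"
  assumes N: "generalized_counting_process M k rate N"
    and a: "0 \<le> a 0" "\<And>l. l < n \<Longrightarrow> a l \<le> a (Suc l)"
  shows "prob {\<omega> \<in> space M. \<forall>l<n. int (N (a (Suc l)) \<omega>) - int (N (a l) \<omega>) = d l} =
    (\<Prod>l<n. prob {\<omega> \<in> space M. int (N (a (Suc l) - a l) \<omega>) = d l})"
proof (cases "n = 0")
  case False
  have a0: "0 \<le> a l" if "l \<le> n" for l
    using that
  proof (induction l)
    case (Suc l)
    then show ?case using a(2)[of l] by simp
  qed (use a in simp)
  let ?X = "\<lambda>l \<omega>. real (N (a (Suc l)) \<omega>) - real (N (a l) \<omega>)"
  have "indep_vars (\<lambda>_. borel) ?X {..<n}"
    using N a by (simp add: generalized_counting_process_def independent_increments_def)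
  then have "prob (\<Inter>l\<in>{..<n}. ?X l -` {of_int (d l)} \<inter> space M) =
      (\<Prod>l\<in>{..<n}. prob (?X l -` {of_int (d l)} \<inter> space M))"
    using False by (intro indep_varsD_finite) auto
  moreover have "?X l -` {of_int (d l)} \<inter> space M =
      {\<omega> \<in> space M. int (N (a (Suc l)) \<omega>) - int (N (a l) \<omega>) = d l}" for l
    by auto
  moreover have "(\<Inter>l\<in>{..<n}. {\<omega> \<in> space M. int (N (a (Suc l)) \<omega>) - int (N (a l) \<omega>) = d l}) =
      {\<omega> \<in> space M. \<forall>l<n. int (N (a (Suc l)) \<omega>) - int (N (a l) \<omega>) = d l}"
    using False by auto
  ultimately show ?thesis
    by (simp add: gcp_increment_prob[OF N] a0 a)
qed (simp add: prob_space)

end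

section \<open>Levy measures on the integer lattice\<close>

lemma borel_measurable_cis [measurable]: "cis \<in> borel_measurable borel"
  by (intro borel_measurable_continuous_onI continuous_intros)

lemma integrable_cis_inner [simp]:
  fixes \<nu> :: "(real ^ 'q) measure"
  assumes "finite_measure \<nu>" and [measurable_cong]: "sets \<nu> = sets borel"
  shows "integrable \<nu> (\<lambda>x. cis (u \<bullet> x))"
  using assms(1) by (intro finite_measure.integrable_const_bound[where B = 1]) auto

lemma integrable_small_jumps:
  fixes \<nu> :: "(real ^ 'q) measure"
  assumes "finite_measure \<nu>" and [measurable_cong]: "sets \<nu> = sets borel"
  shows "integrable \<nu> (\<lambda>x. indicator (cball 0 1) x *\<^sub>R x)"
proof (rule finite_measure.integrable_const_bound[OF assms(1), where B = 1])
  show "AE x in \<nu>. norm (indicator (cball 0 1) x *\<^sub>R x) \<le> 1"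
    by (auto split: split_indicator)
  have [measurable]: "cball 0 1 \<in> sets (borel :: (real ^ 'q) measure)"
    by simp
  show "(\<lambda>x. indicator (cball 0 1) x *\<^sub>R x) \<in> borel_measurable \<nu>"
    by measurable
qed

text \<open>For a finite measure the truncated jumps are integrable on their own, so the compensator
  can be absorbed into the drift.\<close>

lemma levy_khintchine_exponent_finite:
  fixes \<nu> :: "(real ^ 'q) measure"
  assumes fin: "finite_measure \<nu>" and sets [measurable_cong]: "sets \<nu> = sets borel"
  shows "levy_khintchine_exponent b A \<nu> u =
    \<i> * of_real ((b - (LINT x|\<nu>. indicator (cball 0 1) x *\<^sub>R x)) \<bullet> u) - of_real ((u \<bullet> (A *v u)) / 2)
    + (LINT x|\<nu>. cis (u \<bullet> x) - 1)"
proof -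
  note int = integrable_small_jumps[OF fin sets]
  have "(LINT x|\<nu>. cis (u \<bullet> x) - 1 - \<i> * of_real ((u \<bullet> x) * indicator (cball 0 1) x)) =
      (LINT x|\<nu>. (cis (u \<bullet> x) - 1) - \<i> * of_real ((indicator (cball 0 1) x *\<^sub>R x) \<bullet> u))"
    by (simp add: inner_commute mult.commute)
  also have "\<dots> = (LINT x|\<nu>. cis (u \<bullet> x) - 1) -
      (LINT x|\<nu>. \<i> * of_real ((indicator (cball 0 1) x *\<^sub>R x) \<bullet> u))"
    using fin int sets
    by (intro Bochner_Integration.integral_diff integrable_mult_right integrable_of_real
          integrable_inner_left Bochner_Integration.integrable_diff)
       (auto simp: finite_measure.integrable_const)
  also have "(LINT x|\<nu>. \<i> * of_real ((indicator (cball 0 1) x *\<^sub>R x) \<bullet> u)) =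
      \<i> * of_real ((LINT x|\<nu>. indicator (cball 0 1) x *\<^sub>R x) \<bullet> u)"
    using int by (simp only: integral_mult_right_zero integral_complex_of_real integral_inner_left)
  finally show ?thesis
    by (simp add: levy_khintchine_exponent_def inner_diff_left algebra_simps)
qed

text \<open>A single value of \<open>t\<close> fixes the exponent only modulo the periods of the
  exponential, hence the whole family. The modulus at time 1 settles the real parts.\<close>

lemma exp_of_real_mult_eqD:
  fixes v w :: complex
  assumes eq: "\<And>t::real. 0 \<le> t \<Longrightarrow> exp (of_real t * v) = exp (of_real t * w)"
  shows "v = w"
proof -
  define d where "d = v - w"
  have d: "exp (of_real t * d) = 1" if "0 \<le> t" for t
    using eq[OF that] by (simp add: d_def right_diff_distrib exp_diff)
  have "Re d = 0"
    using arg_cong[OF d[of 1], of norm] by simp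
  moreover have "Im d = 0"
  proof (rule ccontr)
    assume "Im d \<noteq> 0"
    \<comment> \<open>At this time the purely imaginary exponent has argument pi or -pi, so the
      exponential is -1 instead of 1.\<close>
    have "Re (exp (of_real (pi / \<bar>Im d\<bar>) * d)) = -1"
      using \<open>Im d \<noteq> 0\<close> \<open>Re d = 0\<close> by (simp add: Re_exp abs_if)
    with d[of "pi / \<bar>Im d\<bar>"] show False by simp
  qed
  ultimately show ?thesis by (simp add: d_def complex_eq_iff)
qed

section \<open>Fourier coefficients on the torus, taken against the uniform distribution on one
  period\<close>

definition period_measure :: "real measure" where
  "period_measure = density lborel (\<lambda>s. ennreal (indicator {0..2 * pi} s / (2 * pi)))"

lemma sets_period_measure [measurable_cong]: "sets period_measure = sets borel"
  by (simp add: period_measure_def)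

lemma sets_PiM_period_measure [measurable_cong]:
  "sets (PiM I (\<lambda>_. period_measure)) = sets (PiM I (\<lambda>_. borel))"
  by (intro sets_PiM_cong refl sets_period_measure)

lemma prob_space_period_measure: "prob_space period_measure"
proof
  have "emeasure period_measure (space period_measure) =
      (\<integral>\<^sup>+ s. ennreal (1 / (2 * pi)) * indicator {0..2 * pi} s \<partial>lborel)"
    by (auto simp: period_measure_def emeasure_density intro!: nn_integral_cong split: split_indicator)
  also have "\<dots> = 1"
    by (subst nn_integral_cmult_indicator) (auto simp flip: ennreal_mult)
  finally show "emeasure period_measure (space period_measure) = 1" .
qed

lemma integral_cis_period:
  fixes n :: int
  shows "(LINT s|period_measure. cis (s * of_int n)) = (if n = 0 then 1 else 0)"
proof -
  have "(LINT s|period_measure. cis (s * of_int n)) =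
      (LINT s|lborel. (1 / (2 * pi)) *\<^sub>R (indicator {0..2 * pi} s *\<^sub>R cis (s * of_int n)))"
    unfolding period_measure_def by (subst integral_density) (auto simp: divide_simps)
  also have "\<dots> = (1 / (2 * pi)) *\<^sub>R (LINT s|lborel. indicator {0..2 * pi} s *\<^sub>R cis (s * of_int n))"
    by (rule integral_scaleR_right)
  also have "(LINT s|lborel. indicator {0..2 * pi} s *\<^sub>R cis (s * of_int n)) =
      (if n = 0 then 2 * pi else 0)"
  proof (cases "n = 0")
    case False
    have "(LINT s|lborel. indicator {0..2 * pi} s *\<^sub>R cis (s * of_int n)) =
        cis (2 * pi * of_int n) / (\<i> * of_int n) - cis (0 * of_int n) / (\<i> * of_int n)"
    proof (rule integral_FTC_atLeastAtMost)
      fix s :: real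
      have "((\<lambda>z. exp (\<i> * z * of_int n) / (\<i> * of_int n)) has_field_derivative
          exp (\<i> * of_real s * of_int n)) (at (of_real s))"
        using False by (auto intro!: derivative_eq_intros)
      from has_vector_derivative_real_field[OF this]
      show "((\<lambda>s. cis (s * of_int n) / (\<i> * of_int n)) has_vector_derivative cis (s * of_int n))
          (at s within {0..2 * pi})"
        by (simp add: cis_conv_exp mult.assoc has_vector_derivative_at_within)
    qed (auto intro!: continuous_intros)
    also have "cis (2 * pi * of_int n) = 1"
      using cis_multiple_2pi[of "of_int n"] by simp
    finally show ?thesis using False by simp
  qed (simp add: scaleR_conv_of_real)
  finally show ?thesis by (simp add: scaleR_conv_of_real)
qed

lemma cis_sum: "cis (sum f I) = (\<Prod>i\<in>I. cis (f i))"
  by (induction I rule: infinite_finite_induct) (simp_all flip: cis_mult)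

lemma integral_cis_torus:
  fixes n :: "'q::finite \<Rightarrow> int"
  shows "(LINT s|PiM UNIV (\<lambda>_. period_measure). cis (\<Sum>i\<in>UNIV. s i * of_int (n i))) =
    (if n = (\<lambda>_. 0) then 1 else 0)"
proof -
  interpret period: prob_space period_measure by (rule prob_space_period_measure)
  interpret product_sigma_finite "\<lambda>_::'q. period_measure" ..
  have "(LINT s|PiM UNIV (\<lambda>_. period_measure). cis (\<Sum>i\<in>UNIV. s i * of_int (n i))) =
      (LINT s|PiM UNIV (\<lambda>_. period_measure). (\<Prod>i\<in>UNIV. cis (s i * of_int (n i))))"
    by (simp add: cis_sum)
  also have "\<dots> = (\<Prod>i\<in>UNIV. (LINT s|period_measure. cis (s * of_int (n i))))"
    by (rule product_integral_prod)
       (auto intro!: period.integrable_const_bound[where B = 1])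
  also have "\<dots> = (if n = (\<lambda>_. 0) then 1 else 0)"
    by (auto simp: integral_cis_period fun_eq_iff)
  finally show ?thesis .
qed

text \<open>Joint measurability in frequency and point, as required for exchanging integrals. The
  shift \<open>c\<close> is a lattice point for point masses and 0 for the plain transform.\<close>

lemma measurable_lattice_phase:
  fixes c :: "'q::finite \<Rightarrow> real"
  shows "(\<lambda>p. cis (\<Sum>i\<in>UNIV. fst p i * (snd p $ i - c i))) \<in>
    borel_measurable (PiM UNIV (\<lambda>_. borel) \<Otimes>\<^sub>M (borel :: (real ^ 'q) measure))"
proof -
  have "(\<lambda>p. fst p i) \<in> borel_measurable (PiM UNIV (\<lambda>_. borel) \<Otimes>\<^sub>M (borel :: (real ^ 'q) measure))"
    for i :: 'q
    by (rule measurable_compose[OF measurable_fst measurable_component_singleton]) simp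
  moreover have "(\<lambda>p. snd p $ i) \<in> borel_measurable (PiM UNIV (\<lambda>_. borel) \<Otimes>\<^sub>M (borel :: (real ^ 'q) measure))"
    for i :: 'q
    by (rule measurable_compose[OF measurable_snd borel_measurable_nth])
  ultimately show ?thesis
    by (intro measurable_compose[OF _ borel_measurable_cis] borel_measurable_sum
          borel_measurable_times borel_measurable_diff borel_measurable_const)
qed

text \<open>Fourier inversion. After the integrals are exchanged, orthogonality of the characters
  turns the integral over the torus into the indicator of the point given by \<open>n\<close>,
  because \<open>x\<close> has integer coordinates almost everywhere.\<close>

lemma lattice_point_mass:
  fixes \<nu> :: "(real ^ 'q) measure" and n :: "'q \<Rightarrow> int"
  assumes fin: "finite_measure \<nu>" and sets [measurable_cong]: "sets \<nu> = sets borel"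
    and lattice: "AE x in \<nu>. \<forall>i. x $ i \<in> \<int>"
  shows "of_real (measure \<nu> {\<chi> i. of_int (n i)}) =
    (LINT s|PiM UNIV (\<lambda>_. period_measure).
      cis (- (\<Sum>i\<in>UNIV. s i * of_int (n i))) * (LINT x|\<nu>. cis ((\<chi> i. s i) \<bullet> x)))"
proof -
  interpret finite_measure \<nu> by fact
  interpret period: prob_space "PiM (UNIV :: 'q set) (\<lambda>_. period_measure)"
    by (intro prob_space_PiM prob_space_period_measure)
  interpret PS: pair_sigma_finite "PiM (UNIV :: 'q set) (\<lambda>_. period_measure)" \<nu> ..
  interpret PF: finite_measure "PiM (UNIV :: 'q set) (\<lambda>_. period_measure) \<Otimes>\<^sub>M \<nu>"
    by (intro finite_measure_pair_measure period.finite_measure_axioms fin)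
  have meas: "(\<lambda>p. cis (\<Sum>i\<in>UNIV. fst p i * (snd p $ i - of_int (n i)))) \<in>
      borel_measurable (PiM UNIV (\<lambda>_. period_measure) \<Otimes>\<^sub>M \<nu>)"
    using measurable_lattice_phase
    by (simp add: measurable_cong_sets[OF sets_pair_measure_cong[OF sets_PiM_period_measure sets] refl])
  have meas': "(\<lambda>p. cis (\<Sum>i\<in>UNIV. snd p i * (fst p $ i - of_int (n i)))) \<in>
      borel_measurable (\<nu> \<Otimes>\<^sub>M PiM UNIV (\<lambda>_. period_measure))"
    using measurable_compose[OF measurable_pair_swap' meas] by (simp add: case_prod_beta)
  have "(LINT s|PiM UNIV (\<lambda>_. period_measure).
      cis (- (\<Sum>i\<in>UNIV. s i * of_int (n i))) * (LINT x|\<nu>. cis ((\<chi> i. s i) \<bullet> x))) =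
    (LINT s|PiM UNIV (\<lambda>_. period_measure). LINT x|\<nu>. cis (\<Sum>i\<in>UNIV. s i * (x $ i - of_int (n i))))"
    by (simp add: inner_vec_def cis_mult right_diff_distrib sum_subtractf
        flip: integral_mult_right_zero)
  also have "\<dots> = (LINT x|\<nu>. LINT s|PiM UNIV (\<lambda>_. period_measure).
      cis (\<Sum>i\<in>UNIV. s i * (x $ i - of_int (n i))))"
    by (rule PS.Fubini_integral[symmetric])
       (rule PF.integrable_const_bound[where B = 1], use meas in \<open>auto simp: case_prod_beta\<close>)
  also have "\<dots> = (LINT x|\<nu>. of_real (indicator {\<chi> i. of_int (n i)} x))"
  proof (rule integral_cong_AE)
    show "AE x in \<nu>. (LINT s|PiM UNIV (\<lambda>_. period_measure).
        cis (\<Sum>i\<in>UNIV. s i * (x $ i - of_int (n i)))) =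
        of_real (indicator {\<chi> i. of_int (n i)} x)"
      using lattice
    proof eventually_elim
      case (elim x)
      then have "\<forall>i. \<exists>m::int. x $ i = of_int m" by (auto elim!: Ints_cases)
      then obtain m :: "'q \<Rightarrow> int" where m: "\<And>i. x $ i = of_int (m i)" by metis
      then have "x = (\<chi> i. of_int (n i)) \<longleftrightarrow> (\<lambda>i. m i - n i) = (\<lambda>_. 0)"
        by (auto simp: vec_eq_iff fun_eq_iff)
      then show ?case
        using integral_cis_torus[of "\<lambda>i. m i - n i"] by (simp add: m)
    qed
    show "(\<lambda>x. LINT s|PiM UNIV (\<lambda>_. period_measure).
        cis (\<Sum>i\<in>UNIV. s i * (x $ i - of_int (n i)))) \<in> borel_measurable \<nu>"
      by (rule period.borel_measurable_lebesgue_integral) (use meas' in \<open>simp add: case_prod_beta\<close>)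
  qed simp
  also have "\<dots> = of_real (measure \<nu> {\<chi> i. of_int (n i)})"
    by simp
  finally show ?thesis ..
qed

text \<open>Subtracting 1 hides the total masses, so the two transforms agree only up to a constant
  \<open>c\<close>. A constant has zero Fourier coefficients away from the origin, and at the origin
  both measures vanish by assumption.\<close>

lemma lattice_measure_eqI:
  fixes \<mu> \<nu> :: "(real ^ 'q) measure"
  assumes \<mu>: "finite_measure \<mu>" "sets \<mu> = sets borel" "AE x in \<mu>. \<forall>i. x $ i \<in> \<int>" "emeasure \<mu> {0} = 0"
    and \<nu>: "finite_measure \<nu>" "sets \<nu> = sets borel" "AE x in \<nu>. \<forall>i. x $ i \<in> \<int>" "emeasure \<nu> {0} = 0"
    and eq: "\<And>u. (LINT x|\<mu>. cis (u \<bullet> x) - 1) = (LINT x|\<nu>. cis (u \<bullet> x) - 1)"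
  shows "\<mu> = \<nu>"
proof -
  define Z :: "(real ^ 'q) set" where "Z = range (\<lambda>n :: 'q \<Rightarrow> int. \<chi> i. of_int (n i))"
  have Z: "countable Z" by (simp add: Z_def)
  have Z_borel: "Z \<in> sets borel" by (rule sets.countable[OF _ Z]) simp
  have in_Z: "x \<in> Z" if "\<forall>i. x $ i \<in> \<int>" for x
  proof -
    from that have "\<forall>i. \<exists>m::int. x $ i = of_int m" by (auto elim!: Ints_cases)
    then obtain m :: "'q \<Rightarrow> int" where "\<And>i. x $ i = of_int (m i)" by metis
    then have "x = (\<chi> i. of_int (m i))" by (simp add: vec_eq_iff)
    then show ?thesis by (auto simp: Z_def)
  qed
  interpret \<mu>: finite_measure \<mu> by fact
  interpret \<nu>: finite_measure \<nu> by fact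
  note [measurable_cong] = \<mu>(2) \<nu>(2)
  define c :: complex where "c = of_real (measure \<mu> (space \<mu>) - measure \<nu> (space \<nu>))"
  have cf: "(LINT x|\<mu>. cis (u \<bullet> x)) = (LINT x|\<nu>. cis (u \<bullet> x)) + c" for u
    using eq[of u] by (simp add: \<mu>(1,2) \<nu>(1,2) c_def scaleR_conv_of_real algebra_simps)
  interpret period: prob_space "PiM (UNIV :: 'q set) (\<lambda>_. period_measure)"
    by (intro prob_space_PiM prob_space_period_measure)
  have point: "emeasure \<mu> {x} = emeasure \<nu> {x}" if x: "x \<in> Z" for x
  proof (cases "x = 0")
    case False
    obtain n :: "'q \<Rightarrow> int" where n: "x = (\<chi> i. of_int (n i))" using x by (auto simp: Z_def)
    with False have n0: "(\<lambda>i. - n i) \<noteq> (\<lambda>_. 0)" by (auto simp: vec_eq_iff fun_eq_iff)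
    have int: "integrable (PiM UNIV (\<lambda>_. period_measure))
        (\<lambda>s. cis (- (\<Sum>i\<in>UNIV. s i * of_int (n i))) * (LINT x|\<nu>. cis ((\<chi> i. s i) \<bullet> x)))"
    proof (rule period.integrable_const_bound[where B = "measure \<nu> (space \<nu>)"])
      have "norm (LINT x|\<nu>. cis (u \<bullet> x)) \<le> measure \<nu> (space \<nu>)" for u
        using integral_norm_bound[of \<nu> "\<lambda>x. cis (u \<bullet> x)"] by simp
      then show "AE s in PiM UNIV (\<lambda>_. period_measure). norm (cis (- (\<Sum>i\<in>UNIV. s i * of_int (n i))) *
          (LINT x|\<nu>. cis ((\<chi> i. s i) \<bullet> x))) \<le> measure \<nu> (space \<nu>)"
        by (simp add: norm_mult)
      have "(\<lambda>p. cis (\<Sum>i\<in>UNIV. fst p i * (snd p $ i - 0))) \<in>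
          borel_measurable (PiM UNIV (\<lambda>_. period_measure) \<Otimes>\<^sub>M \<nu>)"
        using measurable_lattice_phase[of "\<lambda>_. 0"]
        by (simp only: measurable_cong_sets[OF sets_pair_measure_cong[OF sets_PiM_period_measure \<nu>(2)] refl])
      then have "(\<lambda>s. LINT x|\<nu>. cis (\<Sum>i\<in>UNIV. s i * x $ i)) \<in> borel_measurable (PiM UNIV (\<lambda>_. period_measure))"
        by (intro \<nu>.borel_measurable_lebesgue_integral) (simp add: case_prod_beta)
      moreover have "(\<lambda>s. cis (- (\<Sum>i\<in>UNIV. s i * of_int (n i)))) \<in> borel_measurable (PiM UNIV (\<lambda>_. period_measure))"
        by measurable
      ultimately show "(\<lambda>s. cis (- (\<Sum>i\<in>UNIV. s i * of_int (n i))) * (LINT x|\<nu>. cis ((\<chi> i. s i) \<bullet> x)))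
          \<in> borel_measurable (PiM UNIV (\<lambda>_. period_measure))"
        by (simp add: inner_vec_def borel_measurable_times)
    qed
    \<comment> \<open>The constant contributes a multiple of the character with frequency
      \<open>- n\<close>; as \<open>x\<close> is not the origin, this character is nontrivial and
      integrates to 0.\<close>
    have "of_real (measure \<mu> {x}) = (LINT s|PiM UNIV (\<lambda>_. period_measure).
        cis (- (\<Sum>i\<in>UNIV. s i * of_int (n i))) * (LINT x|\<nu>. cis ((\<chi> i. s i) \<bullet> x)) +
        c * cis (\<Sum>i\<in>UNIV. s i * of_int (- n i)))"
      unfolding n lattice_point_mass[OF \<mu>(1-3)] cf by (simp add: algebra_simps sum_negf)
    also have "\<dots> = (LINT s|PiM UNIV (\<lambda>_. period_measure).
        cis (- (\<Sum>i\<in>UNIV. s i * of_int (n i))) * (LINT x|\<nu>. cis ((\<chi> i. s i) \<bullet> x))) +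
        (LINT s|PiM UNIV (\<lambda>_. period_measure). c * cis (\<Sum>i\<in>UNIV. s i * of_int (- n i)))"
    proof (rule Bochner_Integration.integral_add[OF int])
      show "integrable (PiM UNIV (\<lambda>_. period_measure)) (\<lambda>s. c * cis (\<Sum>i\<in>UNIV. s i * of_int (- n i)))"
        by (intro integrable_mult_right period.integrable_const_bound[where B = 1]) auto
    qed
    also have "\<dots> = of_real (measure \<nu> {x}) +
        c * (LINT s|PiM UNIV (\<lambda>_. period_measure). cis (\<Sum>i\<in>UNIV. s i * of_int (- n i)))"
      unfolding n lattice_point_mass[OF \<nu>(1-3)] by simp
    also have "(LINT s|PiM UNIV (\<lambda>_. period_measure). cis (\<Sum>i\<in>UNIV. s i * of_int (- n i))) = 0"
      unfolding integral_cis_torus using n0 by simp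
    finally show ?thesis by (simp add: \<mu>.emeasure_eq_measure \<nu>.emeasure_eq_measure)
  qed (simp add: assms)
  show ?thesis
  proof (rule measure_eqI)
    fix B assume "B \<in> sets \<mu>"
    then have [measurable]: "B \<in> sets borel" by (simp add: \<mu>)
    have BZ: "countable (B \<inter> Z)" using Z by auto
    have "emeasure \<mu> B = emeasure \<mu> (B \<inter> Z)"
      using \<mu>(3) by (intro emeasure_eq_AE) (auto elim: eventually_mono intro: in_Z simp: \<mu>(2) Z_borel)
    also have "\<dots> = emeasure \<nu> (B \<inter> Z)"
    proof -
      have "emeasure \<mu> (B \<inter> Z) = (\<integral>\<^sup>+ x. emeasure \<mu> {x} \<partial>count_space (B \<inter> Z))"
        by (rule emeasure_countable_singleton[OF _ BZ]) (simp add: \<mu>(2))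
      also have "\<dots> = (\<integral>\<^sup>+ x. emeasure \<nu> {x} \<partial>count_space (B \<inter> Z))"
        by (rule nn_integral_cong) (simp add: point)
      also have "\<dots> = emeasure \<nu> (B \<inter> Z)"
        by (rule emeasure_countable_singleton[OF _ BZ, symmetric]) (simp add: \<nu>(2))
      finally show ?thesis .
    qed
    also have "\<dots> = emeasure \<nu> B"
      using \<nu>(3) by (intro emeasure_eq_AE) (auto elim: eventually_mono intro: in_Z simp: \<nu>(2) Z_borel)
    finally show "emeasure \<mu> B = emeasure \<nu> B" .
  qed (simp add: \<mu> \<nu>)
qed

section \<open>The Levy-Khintchine integral and uniqueness for periodic exponents\<close>

lemma integrable_min_norm_sq:
  fixes \<nu> :: "(real ^ 'q) measure"
  assumes [measurable_cong]: "sets \<nu> = sets borel"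
    and "(\<integral>\<^sup>+ x. ennreal (min 1 ((norm x)\<^sup>2)) \<partial>\<nu>) < \<infinity>"
  shows "integrable \<nu> (\<lambda>x. min 1 ((norm x)\<^sup>2))"
  using assms(2) by (intro integrableI_nonneg) auto

lemma norm_cis_minus_linear_le:
  fixes y :: real
  shows "norm (cis y - 1 - \<i> * of_real y) \<le> y\<^sup>2"
proof -
  have "norm (cis y - 1 - \<i> * of_real y) \<le> \<bar>y\<bar> ^ Suc 1 / fact (Suc 1)"
    using iexp_approx1[of y 1] by (simp add: cis_conv_exp algebra_simps)
  also have "\<dots> \<le> y\<^sup>2"
    by (simp add: power2_eq_square)
  finally show ?thesis .
qed

text \<open>Quadratic behaviour on the unit ball and the bound 2 outside it are both covered by the
  majorant \<open>(2 + (norm u)\<^sup>2) * min 1 ((norm x)\<^sup>2)\<close>. Integrability permits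
  taking real parts under the integral.\<close>

lemma integrable_levy_khintchine:
  fixes \<nu> :: "(real ^ 'q) measure"
  assumes sets [measurable_cong]: "sets \<nu> = sets borel"
    and fin: "(\<integral>\<^sup>+ x. ennreal (min 1 ((norm x)\<^sup>2)) \<partial>\<nu>) < \<infinity>"
  shows "integrable \<nu> (\<lambda>x. cis (u \<bullet> x) - 1 - \<i> * of_real ((u \<bullet> x) * indicator (cball 0 1) x))"
proof (rule Bochner_Integration.integrable_bound)
  show "integrable \<nu> (\<lambda>x. (2 + (norm u)\<^sup>2) * min 1 ((norm x)\<^sup>2))"
    by (intro integrable_mult_right integrable_min_norm_sq assms)
  have "norm (cis (u \<bullet> x) - 1 - \<i> * of_real ((u \<bullet> x) * indicator (cball 0 1) x)) \<le>
      (2 + (norm u)\<^sup>2) * min 1 ((norm x)\<^sup>2)" for x :: "real ^ 'q"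
  proof (cases "norm x \<le> 1")
    case True
    have "norm (cis (u \<bullet> x) - 1 - \<i> * of_real (u \<bullet> x)) \<le> (u \<bullet> x)\<^sup>2"
      by (rule norm_cis_minus_linear_le)
    also have "\<dots> \<le> (norm u * norm x)\<^sup>2"
      using Cauchy_Schwarz_ineq2[of u x] by (intro abs_le_square_iff[THEN iffD1]) simp
    also have "\<dots> \<le> (2 + (norm u)\<^sup>2) * (norm x)\<^sup>2"
      by (simp add: power_mult_distrib algebra_simps)
    also have "(norm x)\<^sup>2 = min 1 ((norm x)\<^sup>2)"
      using True by (intro min_absorb2[symmetric] power_le_one) auto
    finally show ?thesis using True by simp
  next
    case False
    have "norm (cis (u \<bullet> x) - 1) \<le> 2"
      using norm_triangle_ineq4[of "cis (u \<bullet> x)" 1] by simp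
    moreover have "min 1 ((norm x)\<^sup>2) = 1"
      using False by (simp add: min_def one_le_power)
    ultimately show ?thesis
      using False by (simp add: add_increasing2)
  qed
  then show "AE x in \<nu>. norm (cis (u \<bullet> x) - 1 - \<i> * of_real ((u \<bullet> x) * indicator (cball 0 1) x)) \<le>
      norm ((2 + (norm u)\<^sup>2) * min 1 ((norm x)\<^sup>2))"
    by (intro AE_I2) (metis norm_ge_zero order_trans real_norm_def abs_ge_self)
  have [measurable]: "cball 0 1 \<in> sets (borel :: (real ^ 'q) measure)" by simp
  show "(\<lambda>x. cis (u \<bullet> x) - 1 - \<i> * of_real ((u \<bullet> x) * indicator (cball 0 1) x)) \<in> borel_measurable \<nu>"
    by measurable
qed

text \<open>Testing the form at the sum and the difference of two basis vectors yields twice an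
  entry and its negative, and both are nonnegative.\<close>

lemma psd_zero_diagonal:
  fixes A :: "real ^ 'q ^ 'q"
  assumes sym: "transpose A = A" and psd: "\<And>u. 0 \<le> u \<bullet> (A *v u)"
    and diag: "\<And>i. A $ i $ i = 0"
  shows "A = 0"
proof -
  have entry: "axis i 1 \<bullet> (A *v axis j 1) = A $ i $ j" for i j
    by (simp add: inner_axis' matrix_vector_mult_basis column_def)
  have "A $ i $ j = 0" for i j
  proof -
    have "A $ j $ i = A $ i $ j"
      using arg_cong[OF sym, of "\<lambda>B. B $ i $ j"] by (simp add: transpose_def)
    then show ?thesis
      using psd[of "axis i 1 + axis j 1"] psd[of "axis i 1 - axis j 1"]
      by (simp add: matrix_vector_right_distrib matrix_vector_mult_diff_distrib inner_add_left
          inner_add_right inner_diff_left inner_diff_right entry diag)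
  qed
  then show ?thesis by (simp add: vec_eq_iff)
qed

text \<open>Evaluating the exponent at the periods \<open>2\<pi>e\<^sub>i\<close> of the right-hand side shows that \<open>\<nu>\<close> is
  concentrated on the integer lattice and that the Gaussian part and the drift vanish.\<close>

lemma levy_measure_lattice_unique:
  fixes \<nu> \<nu>' :: "(real ^ 'q) measure"
  assumes sets [measurable_cong]: "sets \<nu> = sets borel" and zero: "emeasure \<nu> {0} = 0"
    and fin: "(\<integral>\<^sup>+ x. ennreal (min 1 ((norm x)\<^sup>2)) \<partial>\<nu>) < \<infinity>"
    and sym: "transpose A = A" and psd: "\<And>u. 0 \<le> u \<bullet> (A *v u)"
    and \<nu>': "finite_measure \<nu>'" "sets \<nu>' = sets borel" "AE x in \<nu>'. \<forall>i. x $ i \<in> \<int>" "emeasure \<nu>' {0} = 0"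
    and eq: "\<And>u. levy_khintchine_exponent b A \<nu> u = (LINT x|\<nu>'. cis (u \<bullet> x) - 1)"
  shows "\<nu> = \<nu>'"
proof -
  define e :: "'q \<Rightarrow> real ^ 'q" where "e i = axis i (2 * pi)" for i
  have e_inner: "e i \<bullet> x = 2 * pi * x $ i" for i x
    by (simp add: e_def inner_axis')
  have cis_lattice: "cis (e i \<bullet> x) = 1" if "\<forall>i. x $ i \<in> \<int>" for i x
    unfolding e_inner using that by (intro cis_multiple_2pi) simp
  have rhs0: "(LINT x|\<nu>'. cis (e i \<bullet> x) - 1) = 0" for i
  proof -
    have "AE x in \<nu>'. cis (e i \<bullet> x) - 1 = 0"
      using \<nu>'(3) by eventually_elim (simp add: cis_lattice)
    then show ?thesis by (rule integral_eq_zero_AE)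
  qed
  have *: "e i \<bullet> (A *v e i) = 0 \<and> (AE x in \<nu>. x $ i \<in> \<int>)" for i
  proof -
    note int = integrable_levy_khintchine[OF sets fin, of "e i"]
    \<comment> \<open>Drift and compensator disappear in the real part. The right-hand side is 0 at
      \<open>e i\<close>, so the Gaussian term and the integral of
      \<open>1 - cos (e i \<bullet> x)\<close>, both nonnegative, add up to 0 and vanish
      separately.\<close>
    have "Re (LINT x|\<nu>. cis (e i \<bullet> x) - 1 - \<i> * of_real ((e i \<bullet> x) * indicator (cball 0 1) x)) =
        (LINT x|\<nu>. cos (e i \<bullet> x) - 1)"
      by (subst integral_Re[OF int, symmetric]) simp
    also have "\<dots> = - (LINT x|\<nu>. 1 - cos (e i \<bullet> x))"
      by (simp flip: Bochner_Integration.integral_minus)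
    finally have "e i \<bullet> (A *v e i) / 2 + (LINT x|\<nu>. 1 - cos (e i \<bullet> x)) = 0"
      using arg_cong[OF eq[of "e i"], of Re] by (simp add: levy_khintchine_exponent_def rhs0)
    moreover have "0 \<le> (LINT x|\<nu>. 1 - cos (e i \<bullet> x))"
      by (intro integral_nonneg_AE AE_I2) simp
    ultimately have "e i \<bullet> (A *v e i) = 0" and int0: "(LINT x|\<nu>. 1 - cos (e i \<bullet> x)) = 0"
      using psd[of "e i"] by linarith+
    have "integrable \<nu> (\<lambda>x. - Re (cis (e i \<bullet> x) - 1 - \<i> * of_real ((e i \<bullet> x) * indicator (cball 0 1) x)))"
      by (intro integrable_minus integrable_Re int)
    then have "integrable \<nu> (\<lambda>x. 1 - cos (e i \<bullet> x))" by simp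
    from integral_nonneg_eq_0_iff_AE[OF this] int0 have "AE x in \<nu>. 1 - cos (e i \<bullet> x) = 0"
      by simp
    then have "AE x in \<nu>. x $ i \<in> \<int>"
    proof eventually_elim
      case (elim x)
      then obtain m :: int where "2 * pi * x $ i = m * 2 * pi"
        by (auto simp: e_inner cos_one_2pi_int)
      then show ?case by simp
    qed
    with \<open>e i \<bullet> (A *v e i) = 0\<close> show ?thesis by simp
  qed
  have "A $ i $ i = 0" for i
  proof -
    have "e i = (2 * pi) *\<^sub>R axis i 1" by (simp add: e_def vec_eq_iff axis_def)
    with * [of i] have "axis i 1 \<bullet> (A *v axis i 1) = 0"
      by (simp add: matrix_vector_mult_scaleR)
    then show ?thesis by (simp add: inner_axis' matrix_vector_mult_basis column_def)
  qed
  from psd_zero_diagonal[OF sym psd this] have A: "A = 0" .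
  have lattice: "AE x in \<nu>. \<forall>i. x $ i \<in> \<int>"
    using * by (simp add: AE_all_countable)
  have nz: "AE x in \<nu>. x \<noteq> 0"
    by (rule AE_I[of _ _ "{0}"]) (use zero sets in auto)
  \<comment> \<open>A nonzero lattice point has norm at least 1, so the integrability condition on
    Levy measures turns into finiteness of the measure.\<close>
  have "AE x in \<nu>. min 1 ((norm x)\<^sup>2) = 1"
    using lattice nz
  proof eventually_elim
    case (elim x)
    then obtain i where "x $ i \<noteq> 0" by (auto simp: vec_eq_iff)
    with elim have "1 \<le> \<bar>x $ i\<bar>" by (intro Ints_nonzero_abs_ge1) auto
    also have "\<dots> \<le> norm x" by (rule component_le_norm_cart)
    finally show ?case by (simp add: min_def one_le_power)
  qed
  then have "emeasure \<nu> (space \<nu>) = (\<integral>\<^sup>+ x. ennreal (min 1 ((norm x)\<^sup>2)) \<partial>\<nu>)"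
    by (subst nn_integral_cong_AE[where v = "\<lambda>_. 1"]) auto
  then have finite: "finite_measure \<nu>" using fin by (intro finite_measureI) auto
  define d where "d = b - (LINT x|\<nu>. indicator (cball 0 1) x *\<^sub>R x)"
  have exponent: "\<i> * of_real (d \<bullet> u) + (LINT x|\<nu>. cis (u \<bullet> x) - 1) = (LINT x|\<nu>'. cis (u \<bullet> x) - 1)" for u
    using eq[of u] unfolding levy_khintchine_exponent_finite[OF finite sets] by (simp add: A d_def)
  \<comment> \<open>At \<open>e i\<close> both jump integrals vanish by periodicity, which leaves
    the drift term alone.\<close>
  have "d $ i = 0" for i
  proof -
    have "AE x in \<nu>. cis (e i \<bullet> x) - 1 = 0"
      using lattice by eventually_elim (simp add: cis_lattice)
    then have "(LINT x|\<nu>. cis (e i \<bullet> x) - 1) = 0" by (rule integral_eq_zero_AE)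
    then show ?thesis
      using exponent[of "e i"] rhs0[of i] by (simp add: inner_commute[of d] e_inner)
  qed
  then have "d = 0" by (simp add: vec_eq_iff)
  then show ?thesis
    using exponent by (intro lattice_measure_eqI finite sets lattice zero \<nu>') simp
qed

section \<open>The subordinated process\<close>

lemma measurable_path_space_component [measurable]:
  "0 \<le> t \<Longrightarrow> (\<lambda>v. v t) \<in> measurable path_space (count_space UNIV)"
  unfolding path_space_def by (rule measurable_component_singleton) simp

lemma sample_path_apply [simp]: "0 \<le> t \<Longrightarrow> sample_path N \<omega> t = N t \<omega>"
  by (simp add: sample_path_def)

lemma measurable_sample_path:
  assumes "\<And>t. 0 \<le> t \<Longrightarrow> N t \<in> measurable P (count_space UNIV)"
  shows "sample_path N \<in> measurable P path_space"
  unfolding path_space_def sample_path_def by (rule measurable_restrict) (use assms in auto)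

lemma measurable_fun_count_space:
  fixes f :: "'i::finite \<Rightarrow> 'a \<Rightarrow> 'b::countable"
  assumes [measurable]: "\<And>i. f i \<in> measurable P (count_space UNIV)"
  shows "(\<lambda>\<omega> i. f i \<omega>) \<in> measurable P (count_space UNIV)"
proof (subst measurable_count_space_eq2_countable, intro conjI ballI)
  fix x :: "'i \<Rightarrow> 'b"
  have "{\<omega> \<in> space P. \<forall>i. f i \<omega> = x i} \<in> sets P" by measurable
  also have "{\<omega> \<in> space P. \<forall>i. f i \<omega> = x i} = (\<lambda>\<omega> i. f i \<omega>) -` {x} \<inter> space P"
    by auto
  finally show "(\<lambda>\<omega> i. f i \<omega>) -` {x} \<inter> space P \<in> sets P" .
qed auto

lemma pred_le_countable [measurable (raw)]:
  fixes f g :: "'a \<Rightarrow> 'b::{countable, ord}"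
  assumes "f \<in> measurable P (count_space UNIV)" "g \<in> measurable P (count_space UNIV)"
  shows "Measurable.pred P (\<lambda>\<omega>. f \<omega> \<le> g \<omega>)"
proof (rule measurable_compose_countable[OF _ assms(1)])
  show "Measurable.pred P (\<lambda>\<omega>. i \<le> g \<omega>)" for i
    by (rule measurable_compose_countable[OF _ assms(2)]) simp
qed

text \<open>Writes truncated subtraction as a Borel function of the real difference, the form in
  which increments are assumed to be independent.\<close>

lemma nat_floor_real_diff: "nat \<lfloor>real a - real b\<rfloor> = a - b"
proof -
  have "real a - real b = of_int (int a - int b)" by simp
  then have "\<lfloor>real a - real b\<rfloor> = int a - int b" by (metis floor_of_int)
  then show ?thesis by simp
qed

section \<open>Increments of the subordinated process, by conditioning on the path of
  \<open>M0\<close>\<close>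

locale igcp = prob_space P for P :: "'w measure" +
  fixes M :: "'q::finite \<Rightarrow> real \<Rightarrow> 'w \<Rightarrow> nat" and k :: "'q \<Rightarrow> nat" and lam :: "'q \<Rightarrow> nat \<Rightarrow> real"
    and M0 :: "real \<Rightarrow> 'w \<Rightarrow> nat" and k0 :: nat and mu :: "nat \<Rightarrow> real"
  assumes M: "\<And>i. generalized_counting_process P (k i) (lam i) (M i)"
    and M0: "generalized_counting_process P k0 mu M0"
    and indep_M: "indep_vars (\<lambda>_. path_space) (\<lambda>i. sample_path (M i)) UNIV"
    and indep_M0: "indep_set
           (sets (vimage_algebra (space P) (sample_path M0) path_space))
           (sets (vimage_algebra (space P) (\<lambda>\<omega> i. sample_path (M i) \<omega>) (PiM UNIV (\<lambda>_. path_space))))"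
begin

lemma measurable_M [measurable]: "0 \<le> t \<Longrightarrow> M i t \<in> measurable P (count_space UNIV)"
  by (rule gcp_measurable[OF M])

lemma measurable_M0 [measurable]: "0 \<le> t \<Longrightarrow> M0 t \<in> measurable P (count_space UNIV)"
  by (rule gcp_measurable[OF M0])

lemma measurable_M_M0 [measurable]:
  "0 \<le> t \<Longrightarrow> (\<lambda>\<omega>. M i (real (M0 t \<omega>)) \<omega>) \<in> measurable P (count_space UNIV)"
  by (rule measurable_compose_countable[where g = "M0 t"]) auto

abbreviation paths :: "'w \<Rightarrow> 'q \<Rightarrow> real \<Rightarrow> nat" where
  "paths \<equiv> \<lambda>\<omega> i. sample_path (M i) \<omega>"

lemma path_integral:
  fixes f :: "(real \<Rightarrow> nat) \<times> ('q \<Rightarrow> real \<Rightarrow> nat) \<Rightarrow> 'd :: {banach, second_countable_topology}"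
  assumes "f \<in> borel_measurable (path_space \<Otimes>\<^sub>M PiM UNIV (\<lambda>_. path_space))" "\<And>z. norm (f z) \<le> B"
  shows "(LINT \<omega>|P. f (sample_path M0 \<omega>, paths \<omega>)) =
    (LINT \<omega>|P. LINT \<omega>'|P. f (sample_path M0 \<omega>, paths \<omega>'))"
proof (rule indep_set_vimage_algebra_integral[OF _ _ indep_M0 assms])
  show "sample_path M0 \<in> measurable P path_space"
    by (rule measurable_sample_path) simp
  have "(\<lambda>\<omega>. \<lambda>i\<in>UNIV. sample_path (M i) \<omega>) \<in> measurable P (PiM UNIV (\<lambda>_. path_space))"
    by (intro measurable_restrict measurable_sample_path) simp
  then show "paths \<in> measurable P (PiM UNIV (\<lambda>_. path_space))"
    by (simp add: restrict_def)
qed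

text \<open>The random time takes countably many values, so the evaluations at fixed times
  \<open>real n\<close> can be glued along the events where it equals \<open>n\<close>.\<close>

lemma measurable_subordinated_path:
  fixes i :: 'q
  assumes "0 \<le> t"
  shows "(\<lambda>z. snd z i (real (fst z t))) \<in>
    measurable (path_space \<Otimes>\<^sub>M PiM UNIV (\<lambda>_. path_space)) (count_space (UNIV :: nat set))"
proof -
  let ?S = "path_space \<Otimes>\<^sub>M PiM (UNIV :: 'q set) (\<lambda>_. path_space)"
  have time: "(\<lambda>z. fst z t) \<in> measurable ?S (count_space UNIV)"
    by (rule measurable_compose[OF measurable_fst measurable_path_space_component[OF assms]])
  have path: "(\<lambda>z. snd z i) \<in> measurable ?S path_space"
    by (rule measurable_compose[OF measurable_snd measurable_component_singleton]) simp
  have "(\<lambda>z. snd z i (real n)) \<in> measurable ?S (count_space UNIV)" for n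
    by (rule measurable_compose[OF path measurable_path_space_component]) simp
  from measurable_compose_countable[OF this time] show ?thesis .
qed

text \<open>By independence, this is the probability that the vector of all \<open>M i\<close>
  equals \<open>d\<close> at the integer time \<open>a\<close>. Integer values of \<open>d\<close>
  match those of increments.\<close>

definition step_prob :: "nat \<Rightarrow> ('q \<Rightarrow> int) \<Rightarrow> real" where
  "step_prob a d = (\<Prod>i\<in>UNIV. prob {\<omega> \<in> space P. int (M i (real a) \<omega>) = d i})"

lemma step_prob_bounds: "0 \<le> step_prob a d" "step_prob a d \<le> 1"
  by (auto simp: step_prob_def intro!: prod_nonneg prod_le_1)

text \<open>Independence of the coordinates \<open>i\<close> comes first, then independence and
  stationarity in time within each coordinate; exchanging the two products collects the factors into
  \<open>step_prob\<close>.\<close>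

lemma increments_prob:
  fixes a :: "nat \<Rightarrow> nat"
  assumes a: "\<And>l. l < n \<Longrightarrow> a l \<le> a (Suc l)"
  shows "prob {\<omega> \<in> space P. \<forall>l<n. \<forall>i. int (M i (real (a (Suc l))) \<omega>) - int (M i (real (a l)) \<omega>) = d l i} =
    (\<Prod>l<n. step_prob (a (Suc l) - a l) (d l))"
proof -
  define A where "A i = {v \<in> space path_space.
    \<forall>l<n. int (v (real (a (Suc l)))) - int (v (real (a l))) = d l i}" for i
  have A: "A i \<in> sets path_space" for i
    unfolding A_def by measurable
  have "prob (\<Inter>i\<in>UNIV. sample_path (M i) -` A i \<inter> space P) =
      (\<Prod>i\<in>UNIV. prob (sample_path (M i) -` A i \<inter> space P))"
    by (rule indep_varsD_finite[OF indep_M]) (auto intro: A)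
  moreover have vimage: "sample_path (M i) -` A i \<inter> space P =
      {\<omega> \<in> space P. \<forall>l<n. int (M i (real (a (Suc l))) \<omega>) - int (M i (real (a l)) \<omega>) = d l i}" for i
    using measurable_space[OF measurable_sample_path[of "M i" P]] by (auto simp: A_def)
  moreover have "prob (sample_path (M i) -` A i \<inter> space P) =
      (\<Prod>l<n. prob {\<omega> \<in> space P. int (M i (real (a (Suc l) - a l)) \<omega>) = d l i})" for i
    unfolding vimage using a by (subst gcp_increments_prob[OF M]) (auto simp: of_nat_diff)
  moreover have "(\<Inter>i\<in>UNIV. sample_path (M i) -` A i \<inter> space P) =
      {\<omega> \<in> space P. \<forall>l<n. \<forall>i. int (M i (real (a (Suc l))) \<omega>) - int (M i (real (a l)) \<omega>) = d l i}"
    unfolding vimage by auto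
  ultimately show ?thesis
    unfolding step_prob_def by (simp add: prod.swap[of _ "{..<n}"])
qed

text \<open>Keeping increments in a countable type reduces questions about their laws to point
  probabilities; \<open>increment_eq_vec\<close> leads back to vectors.\<close>

definition igcp_increment :: "real \<Rightarrow> real \<Rightarrow> 'w \<Rightarrow> 'q \<Rightarrow> int" where
  "igcp_increment s t \<omega> = (\<lambda>i. int (M i (real (M0 t \<omega>)) \<omega>) - int (M i (real (M0 s \<omega>)) \<omega>))"

lemma measurable_igcp_increment [measurable]:
  assumes [simp]: "0 \<le> s" "0 \<le> t"
  shows "igcp_increment s t \<in> measurable P (count_space UNIV)"
  unfolding igcp_increment_def by (rule measurable_fun_count_space) measurable

lemma increment_eq_vec:
  "multivariate_igcp M0 M t \<omega> - multivariate_igcp M0 M s \<omega> = (\<chi> i. of_int (igcp_increment s t \<omega> i))"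
  by (simp add: multivariate_igcp_def igcp_increment_def vec_eq_iff)

text \<open>Conditioning on the path of \<open>M\<^sub>0\<close> reduces the increments of the subordinated process to
  those of \<open>M\<close> at integer times.\<close>

lemma igcp_increments_prob:
  fixes t :: "nat \<Rightarrow> real"
  assumes t0 [simp]: "\<And>l. 0 \<le> t l" and t: "\<And>l. l < n \<Longrightarrow> t l \<le> t (Suc l)"
  shows "prob {\<omega> \<in> space P. \<forall>l<n. igcp_increment (t l) (t (Suc l)) \<omega> = d l} =
    (\<Prod>l<n. (LINT \<omega>|P. step_prob (M0 (t (Suc l) - t l) \<omega>) (d l)))"
proof -
  let ?S = "path_space \<Otimes>\<^sub>M PiM (UNIV :: 'q set) (\<lambda>_. path_space)"
  \<comment> \<open>The values of \<open>M0\<close> are ordered only almost surely, while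
    \<open>increments_prob\<close> asks for ordered times; the event is therefore intersected with
    \<open>mono\<close> until the inner integral has been computed.\<close>
  define mono where "mono \<omega> \<longleftrightarrow> (\<forall>l<n. M0 (t l) \<omega> \<le> M0 (t (Suc l)) \<omega>)" for \<omega>
  have mono: "AE \<omega> in P. mono \<omega>"
    using gcp_AE_mono[OF M0]
  proof eventually_elim
    case (elim \<omega>)
    show ?case unfolding mono_def by (intro allI impI elim[rule_format] t0 t)
  qed
  have [measurable]: "Measurable.pred P mono"
    unfolding mono_def
  proof (intro pred_intros_countable)
    fix l
    have [measurable]: "M0 (t l) \<in> measurable P (count_space UNIV)"
        "M0 (t (Suc l)) \<in> measurable P (count_space UNIV)"
      by simp_all
    show "Measurable.pred P (\<lambda>\<omega>. l < n \<longrightarrow> M0 (t l) \<omega> \<le> M0 (t (Suc l)) \<omega>)"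
      by measurable
  qed
  \<comment> \<open>The event is rewritten as a set of pairs of paths, since independence of
    \<open>M0\<close> and \<open>M\<close> is assumed on path space.\<close>
  define E where "E = {z \<in> space ?S. \<forall>l i. l < n \<longrightarrow> fst z (t l) \<le> fst z (t (Suc l)) \<and>
    int (snd z i (real (fst z (t (Suc l))))) - int (snd z i (real (fst z (t l)))) = d l i}"
  have E: "E \<in> sets ?S"
    unfolding E_def
  proof (intro sets.sets_Collect_countable_All)
    fix l and i :: 'q
    have [measurable]: "(\<lambda>z. fst z (t r)) \<in> measurable ?S (count_space UNIV)" for r
      by (rule measurable_compose[OF measurable_fst measurable_path_space_component[OF t0]])
    have [measurable]: "(\<lambda>z. snd z i (real (fst z (t r)))) \<in> measurable ?S (count_space UNIV)" for r
      by (rule measurable_subordinated_path[OF t0])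
    show "{z \<in> space ?S. l < n \<longrightarrow> fst z (t l) \<le> fst z (t (Suc l)) \<and>
      int (snd z i (real (fst z (t (Suc l))))) - int (snd z i (real (fst z (t l)))) = d l i} \<in> sets ?S"
      by measurable
  qed
  have in_E: "(sample_path M0 \<omega>, paths \<omega>') \<in> E \<longleftrightarrow>
      mono \<omega> \<and> (\<forall>l<n. \<forall>i. int (M i (real (M0 (t (Suc l)) \<omega>)) \<omega>') - int (M i (real (M0 (t l) \<omega>)) \<omega>') = d l i)"
    if "\<omega> \<in> space P" "\<omega>' \<in> space P" for \<omega> \<omega>'
  proof -
    have "sample_path M0 \<omega> \<in> space path_space" "sample_path (M i) \<omega>' \<in> space path_space" for i
      using that measurable_space[OF measurable_sample_path[of M0 P]]
        measurable_space[OF measurable_sample_path[of "M i" P]] by auto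
    then show ?thesis
      by (auto simp: E_def mono_def space_pair_measure space_PiM)
  qed
  have increments: "Measurable.pred P (\<lambda>\<omega>. \<forall>l<n. igcp_increment (t l) (t (Suc l)) \<omega> = d l)"
  proof (intro pred_intros_countable)
    fix l
    have [measurable]: "igcp_increment (t l) (t (Suc l)) \<in> measurable P (count_space UNIV)"
      by simp
    show "Measurable.pred P (\<lambda>\<omega>. l < n \<longrightarrow> igcp_increment (t l) (t (Suc l)) \<omega> = d l)"
      by measurable
  qed
  let ?A = "{\<omega> \<in> space P. \<forall>l<n. igcp_increment (t l) (t (Suc l)) \<omega> = d l}"
  have A: "{\<omega> \<in> space P. mono \<omega> \<and> (\<forall>l<n. igcp_increment (t l) (t (Suc l)) \<omega> = d l)} \<in> sets P" "?A \<in> sets P"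
    using increments by measurable
  then have "prob ?A = prob {\<omega> \<in> space P. mono \<omega> \<and> (\<forall>l<n. igcp_increment (t l) (t (Suc l)) \<omega> = d l)}"
    using mono by (intro measure_eq_AE) auto
  also have "\<dots> = (LINT \<omega>|P. indicator {\<omega> \<in> space P. mono \<omega> \<and>
      (\<forall>l<n. igcp_increment (t l) (t (Suc l)) \<omega> = d l)} \<omega>)"
    using A by simp
  also have "\<dots> = (LINT \<omega>|P. indicator E (sample_path M0 \<omega>, paths \<omega>))"
    by (intro Bochner_Integration.integral_cong)
       (auto simp: indicator_def in_E igcp_increment_def fun_eq_iff)
  also have "\<dots> = (LINT \<omega>|P. LINT \<omega>'|P. indicator E (sample_path M0 \<omega>, paths \<omega>'))"
    using E by (intro path_integral[where B = 1]) auto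
  also have "\<dots> = (LINT \<omega>|P. (if mono \<omega>
      then (\<Prod>l<n. step_prob (M0 (t (Suc l)) \<omega> - M0 (t l) \<omega>) (d l)) else 0))"
  proof (intro Bochner_Integration.integral_cong refl)
    fix \<omega> assume \<omega>: "\<omega> \<in> space P"
    let ?B = "{\<omega>' \<in> space P. \<forall>l<n. \<forall>i.
      int (M i (real (M0 (t (Suc l)) \<omega>)) \<omega>') - int (M i (real (M0 (t l) \<omega>)) \<omega>') = d l i}"
    have B: "?B \<in> sets P" by measurable
    have "(LINT \<omega>'|P. indicator E (sample_path M0 \<omega>, paths \<omega>')) =
        (LINT \<omega>'|P. (if mono \<omega> then indicator ?B \<omega>' else 0))"
      by (intro Bochner_Integration.integral_cong refl) (auto simp: indicator_def in_E \<omega>)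
    also have "\<dots> = (if mono \<omega> then prob ?B else 0)"
      using B by simp
    also have "\<dots> = (if mono \<omega>
        then (\<Prod>l<n. step_prob (M0 (t (Suc l)) \<omega> - M0 (t l) \<omega>) (d l)) else 0)"
      by (auto simp: mono_def intro: increments_prob[where a = "\<lambda>l. M0 (t l) \<omega>"])
    finally show "(LINT \<omega>'|P. indicator E (sample_path M0 \<omega>, paths \<omega>')) = \<dots>" .
  qed
  also have "\<dots> = (LINT \<omega>|P. (\<Prod>l<n. step_prob (M0 (t (Suc l)) \<omega> - M0 (t l) \<omega>) (d l)))"
    using mono by (intro integral_cong_AE) auto
  \<comment> \<open>Each factor becomes a function of one real increment of \<open>M0\<close>, to
    which the assumed independence applies.\<close>
  also have "\<dots> = (LINT \<omega>|P. (\<Prod>l<n. step_prob (nat \<lfloor>real (M0 (t (Suc l)) \<omega>) - real (M0 (t l) \<omega>)\<rfloor>) (d l)))"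
    by (simp add: nat_floor_real_diff)
  also have "\<dots> = (\<Prod>l<n. (LINT \<omega>|P. step_prob (nat \<lfloor>real (M0 (t (Suc l)) \<omega>) - real (M0 (t l) \<omega>)\<rfloor>) (d l)))"
  proof (rule indep_vars_lebesgue_integral)
    have "indep_vars (\<lambda>_. borel) (\<lambda>l \<omega>. real (M0 (t (Suc l)) \<omega>) - real (M0 (t l) \<omega>)) {..<n}"
      using M0 t0 t by (simp add: generalized_counting_process_def independent_increments_def)
    then show "indep_vars (\<lambda>_. borel)
        (\<lambda>l \<omega>. step_prob (nat \<lfloor>real (M0 (t (Suc l)) \<omega>) - real (M0 (t l) \<omega>)\<rfloor>) (d l)) {..<n}"
      by (rule indep_vars_compose2[where Y = "\<lambda>l x. step_prob (nat \<lfloor>x\<rfloor>) (d l)"]) measurable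
  next
    fix l assume "l \<in> {..<n}"
    then show "integrable P (\<lambda>\<omega>. step_prob (nat \<lfloor>real (M0 (t (Suc l)) \<omega>) - real (M0 (t l) \<omega>)\<rfloor>) (d l))"
      by (intro integrable_const_bound[where B = 1]) (auto simp: step_prob_bounds)
  qed simp
  also have "\<dots> = (\<Prod>l<n. (LINT \<omega>|P. step_prob (M0 (t (Suc l) - t l) \<omega>) (d l)))"
  proof (intro prod.cong refl)
    fix l assume l: "l \<in> {..<n}"
    let ?g = "\<lambda>x::real. step_prob (nat \<lfloor>x\<rfloor>) (d l)"
    have "(LINT \<omega>|P. ?g (real (M0 (t (Suc l)) \<omega>) - real (M0 (t l) \<omega>))) =
        integral\<^sup>L (distr P borel (\<lambda>\<omega>. real (M0 (t (Suc l)) \<omega>) - real (M0 (t l) \<omega>))) ?g"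
      using l by (intro integral_distr[symmetric]) auto
    also have "\<dots> = integral\<^sup>L (distr P borel (\<lambda>\<omega>. real (M0 (t (Suc l) - t l) \<omega>))) ?g"
      using l t by (subst gcp_increment_distr[OF M0]) auto
    also have "\<dots> = (LINT \<omega>|P. step_prob (M0 (t (Suc l) - t l) \<omega>) (d l))"
      using l t by (subst integral_distr) auto
    finally show "(LINT \<omega>|P. ?g (real (M0 (t (Suc l)) \<omega>) - real (M0 (t l) \<omega>))) =
        (LINT \<omega>|P. step_prob (M0 (t (Suc l) - t l) \<omega>) (d l))" .
  qed
  finally show ?thesis .
qed

lemma igcp_increment_prob:
  assumes "0 \<le> s" "s \<le> t"
  shows "prob {\<omega> \<in> space P. igcp_increment s t \<omega> = d} = (LINT \<omega>|P. step_prob (M0 (t - s) \<omega>) d)"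
  using igcp_increments_prob[of "\<lambda>l. if l = 0 then s else t" 1 "\<lambda>_. d"] assms
  by (simp add: less_Suc_eq)

text \<open>The joint point probabilities from \<open>igcp_increments_prob\<close> are the products
  of the individual ones from \<open>igcp_increment_prob\<close>, which suffices in a countable
  type.\<close>

lemma independent_increments_igcp: "independent_increments P (multivariate_igcp M0 M)"
  unfolding independent_increments_def
proof (intro allI impI, elim conjE)
  fix n and t' :: "nat \<Rightarrow> real" assume t': "0 \<le> t' 0" "\<forall>i<n. t' i \<le> t' (Suc i)"
  \<comment> \<open>Only the times with index up to \<open>n\<close> are known to be nonnegative;
    freezing the sequence at \<open>t' n\<close> makes this true for every index, as
    \<open>igcp_increments_prob\<close> demands.\<close>
  define t where "t l = t' (min l n)" for l
  have t'_nonneg: "0 \<le> t' l" if "l \<le> n" for l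
    using that
  proof (induction l)
    case (Suc l)
    then show ?case using t'(2)[rule_format, of l] by simp
  qed (use t' in simp)
  then have t [simp]: "0 \<le> t l" and t_mono: "l < n \<Longrightarrow> t l \<le> t (Suc l)" for l
    using t' by (auto simp: t_def)
  have "indep_vars (\<lambda>_. count_space UNIV) (\<lambda>l. igcp_increment (t l) (t (Suc l))) {..<n}"
  proof (rule indep_vars_countableI)
    fix d
    have "(\<Prod>l<n. (LINT \<omega>|P. step_prob (M0 (t (Suc l) - t l) \<omega>) (d l))) =
        (\<Prod>l<n. prob {\<omega> \<in> space P. igcp_increment (t l) (t (Suc l)) \<omega> = d l})"
      by (intro prod.cong refl) (simp add: igcp_increment_prob t_mono)
    with igcp_increments_prob[of t n d]
    show "prob {\<omega> \<in> space P. \<forall>l\<in>{..<n}. igcp_increment (t l) (t (Suc l)) \<omega> = d l} =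
        (\<Prod>l<n. prob {\<omega> \<in> space P. igcp_increment (t l) (t (Suc l)) \<omega> = d l})"
      by (simp add: t_mono Ball_def)
  qed auto
  then have "indep_vars (\<lambda>_. borel)
      (\<lambda>l \<omega>. (\<chi> i. of_int (igcp_increment (t l) (t (Suc l)) \<omega> i)) :: real ^ 'q) {..<n}"
    by (rule indep_vars_compose2[where Y = "\<lambda>_ d. \<chi> i. of_int (d i)"]) simp
  also have "?this \<longleftrightarrow> indep_vars (\<lambda>_. borel)
      (\<lambda>l \<omega>. multivariate_igcp M0 M (t' (Suc l)) \<omega> - multivariate_igcp M0 M (t' l) \<omega>) {..<n}"
    by (rule indep_vars_cong) (auto simp: increment_eq_vec t_def)
  finally show "indep_vars (\<lambda>_. borel)
      (\<lambda>l \<omega>. multivariate_igcp M0 M (t' (Suc l)) \<omega> - multivariate_igcp M0 M (t' l) \<omega>) {..<n}" .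
qed

text \<open>The point probabilities in \<open>igcp_increment_prob\<close> depend on the two times
  only through their difference.\<close>

lemma stationary_increments_igcp: "stationary_increments P (multivariate_igcp M0 M)"
  unfolding stationary_increments_def
proof (intro allI impI)
  fix s t :: real assume st: "0 \<le> s" "0 \<le> t"
  have "distr P (count_space UNIV) (igcp_increment s (s + t)) = distr P (count_space UNIV) (igcp_increment 0 t)"
    using st by (intro distr_countable_eqI) (auto simp: igcp_increment_prob)
  then have "distr (distr P (count_space UNIV) (igcp_increment s (s + t))) borel (\<lambda>d. (\<chi> i. of_int (d i)) :: real ^ 'q) =
      distr (distr P (count_space UNIV) (igcp_increment 0 t)) borel (\<lambda>d. \<chi> i. of_int (d i))"
    by simp
  then show "distr P borel (\<lambda>\<omega>. multivariate_igcp M0 M (s + t) \<omega> - multivariate_igcp M0 M s \<omega>) =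
      distr P borel (\<lambda>\<omega>. multivariate_igcp M0 M t \<omega> - multivariate_igcp M0 M 0 \<omega>)"
    using st by (simp add: increment_eq_vec distr_distr comp_def)
qed

section \<open>Path properties of the subordinated process\<close>

lemma igcp_AE_zero: "AE \<omega> in P. multivariate_igcp M0 M 0 \<omega> = 0"
proof -
  have "AE \<omega> in P. \<forall>i. M i 0 \<omega> = 0"
    unfolding AE_all_countable using gcp_AE_zero[OF M] by simp
  with gcp_AE_zero[OF M0] show ?thesis
    by eventually_elim (simp add: multivariate_igcp_def vec_eq_iff)
qed

lemma igcp_right_continuous:
  "AE \<omega> in P. \<forall>t\<ge>0. continuous (at_right t) (\<lambda>s. multivariate_igcp M0 M s \<omega>)"
proof -
  have "AE \<omega> in P. \<forall>t\<ge>0. continuous (at_right t) (\<lambda>s. real (M0 s \<omega>))"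
    using M0 by (simp add: generalized_counting_process_def)
  then show ?thesis
  proof eventually_elim
    case (elim \<omega>)
    show ?case
    proof (intro allI impI)
      fix t :: real assume "0 \<le> t"
      then have "eventually (\<lambda>s. M0 s \<omega> = M0 t \<omega>) (at_right t)"
        using elim by (intro eventually_const_at_right[of t "\<lambda>s. M0 s \<omega>"]) auto
      then have "eventually (\<lambda>s. multivariate_igcp M0 M s \<omega> = multivariate_igcp M0 M t \<omega>) (at_right t)"
        by eventually_elim (simp add: multivariate_igcp_def)
      then show "continuous (at_right t) (\<lambda>s. multivariate_igcp M0 M s \<omega>)"
        unfolding continuous_within by (rule tendsto_eventually)
    qed
  qed
qed

text \<open>Before \<open>t\<close> a monotone \<open>M0\<close> is bounded by \<open>M0 t\<close>,
  hence takes finitely many values and attains a maximum at some \<open>s0\<close>. From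
  \<open>s0\<close> up to \<open>t\<close> it is constant, and so is the composed path.\<close>

lemma igcp_left_limits:
  "AE \<omega> in P. \<forall>t>0. \<exists>l. ((\<lambda>s. multivariate_igcp M0 M s \<omega>) \<longlongrightarrow> l) (at_left t)"
  using gcp_AE_mono[OF M0]
proof eventually_elim
  case (elim \<omega>)
  show ?case
  proof (intro allI impI)
    fix t :: real assume t: "0 < t"
    define K where "K = Max ((\<lambda>s. M0 s \<omega>) ` {0..<t})"
    have fin: "finite ((\<lambda>s. M0 s \<omega>) ` {0..<t})"
      by (rule finite_subset[of _ "{..M0 t \<omega>}"]) (use elim in auto)
    have "K \<in> (\<lambda>s. M0 s \<omega>) ` {0..<t}"
      unfolding K_def using fin t by (intro Max_in) auto
    then obtain s0 where s0: "0 \<le> s0" "s0 < t" "M0 s0 \<omega> = K" by auto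
    have "eventually (\<lambda>s. s \<in> {s0<..<t}) (at_left t)"
      using s0 by (intro eventually_at_leftI) auto
    then have "eventually (\<lambda>s. multivariate_igcp M0 M s \<omega> = multivariate_igcp M0 M s0 \<omega>) (at_left t)"
    proof eventually_elim
      case (elim s)
      then have "M0 s \<omega> \<le> K"
        unfolding K_def using fin s0 by (intro Max_ge) auto
      moreover have "K \<le> M0 s \<omega>"
        using \<open>\<forall>s t. 0 \<le> s \<longrightarrow> s \<le> t \<longrightarrow> M0 s \<omega> \<le> M0 t \<omega>\<close> s0 elim by auto
      ultimately show ?case
        using s0 by (simp add: multivariate_igcp_def)
    qed
    then show "\<exists>l. ((\<lambda>s. multivariate_igcp M0 M s \<omega>) \<longlongrightarrow> l) (at_left t)"
      by (blast intro: tendsto_eventually)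
  qed
qed

lemma measurable_igcp [measurable]:
  assumes "0 \<le> t"
  shows "multivariate_igcp M0 M t \<in> borel_measurable P"
proof -
  have "(\<lambda>\<omega> i. M i (real (M0 t \<omega>)) \<omega>) \<in> measurable P (count_space UNIV)"
    by (rule measurable_fun_count_space) (use assms in measurable)
  then have "(\<lambda>\<omega>. (\<lambda>n. \<chi> i. real (n i)) (\<lambda>i. M i (real (M0 t \<omega>)) \<omega>) :: real ^ 'q) \<in> borel_measurable P"
    by (rule measurable_compose) simp
  then show ?thesis by (simp add: multivariate_igcp_def[abs_def])
qed

lemma levy_process_igcp: "levy_process P (multivariate_igcp M0 M)"
  unfolding levy_process_def
  using measurable_igcp igcp_AE_zero independent_increments_igcp stationary_increments_igcp
    igcp_right_continuous igcp_left_limits by blast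

end

section \<open>The Levy measure of the subordinated process\<close>

text \<open>Passes from measures to the unordered sums of the theorem. In the extended nonnegative
  reals these are suprema of finite partial sums, which links them to the summable real family
  \<open>pmf p\<close>.\<close>

lemma emeasure_pmf_eq_infsum: "emeasure (measure_pmf p) S = (\<Sum>\<^sub>\<infinity>x\<in>S. ennreal (pmf p x))"
proof -
  note abs = pmf_abs_summable[of p S]
  have sum: "pmf p summable_on S"
    using abs_summable_equivalent[THEN iffD2, OF abs] by simp
  have "emeasure (measure_pmf p) S = ennreal (infsum (pmf p) S)"
    by (simp add: measure_pmf.emeasure_eq_measure measure_pmf_conv_infsetsum infsetsum_infsum[OF abs])
  also have "\<dots> = (SUP F\<in>{F. finite F \<and> F \<subseteq> S}. ennreal (sum (pmf p) F))"
    by (rule infsum_nonneg_is_SUPREMUM_ennreal[OF sum]) simp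
  also have "\<dots> = (SUP F\<in>{F. finite F \<and> F \<subseteq> S}. (\<Sum>x\<in>F. ennreal (pmf p x)))"
    by (subst sum_ennreal) simp_all
  also have "\<dots> = (\<Sum>\<^sub>\<infinity>x\<in>S. ennreal (pmf p x))"
    by (rule nonneg_infsum_complete[symmetric]) simp
  finally show ?thesis .
qed

abbreviation vec_of_nat :: "('q::finite \<Rightarrow> nat) \<Rightarrow> real ^ 'q" where
  "vec_of_nat n \<equiv> \<chi> i. real (n i)"

section \<open>Characteristic functions and the jump measure\<close>

context igcp
begin

text \<open>For \<open>a \<ge> 1\<close> this is the law of the vector of all \<open>M i\<close> at
  time \<open>a\<close>.\<close>

definition step_pmf :: "nat \<Rightarrow> ('q \<Rightarrow> nat) pmf" where
  "step_pmf a = Pi_pmf UNIV undefined (\<lambda>i. gcp_pmf (k i) (lam i) (real a))"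

text \<open>The characteristic function of the vector of all \<open>M i\<close> at time 1, in closed
  form; \<open>char_M_eq\<close> confirms this and shows that integer times correspond to
  powers.\<close>

definition char_M :: "real ^ 'q \<Rightarrow> complex" where
  "char_M u = exp (- (\<Sum>i\<in>UNIV. \<Sum>j=1..k i. of_real (lam i j) * (1 - cis (u $ i) ^ j)))"

lemma char_M_power:
  "char_M u ^ a = (\<Prod>i\<in>UNIV. exp (- of_real (real a) * (\<Sum>j=1..k i. of_real (lam i j) * (1 - cis (u $ i) ^ j))))"
  by (simp add: char_M_def sum_negf flip: exp_of_nat_mult exp_sum sum_distrib_left)

text \<open>Makes \<open>char_M u\<close> an admissible argument for the generating function of
  \<open>M0\<close>. Positive rates give the exponent a nonpositive real part.\<close>

lemma norm_char_M_le: "norm (char_M u) \<le> 1"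
proof -
  have "0 \<le> lam i j * (1 - Re (cis (u $ i) ^ j))" if "j \<in> {1..k i}" for i j
    using gcp_rate_pos[OF M that] by (simp add: Complex.DeMoivre)
  then have "0 \<le> (\<Sum>i\<in>UNIV. \<Sum>j=1..k i. lam i j * (1 - Re (cis (u $ i) ^ j)))"
    by (intro sum_nonneg) auto
  then show ?thesis by (simp add: char_M_def)
qed

lemma cis_inner_vec_of_nat: "cis (u \<bullet> vec_of_nat n) = (\<Prod>i\<in>UNIV. cis (u $ i) ^ n i)"
  by (simp add: inner_vec_def cis_sum Complex.DeMoivre mult.commute)

lemma char_M_eq: "(LINT \<omega>|P. cis (u \<bullet> vec_of_nat (\<lambda>i. M i (real a) \<omega>))) = char_M u ^ a"
proof -
  have "indep_vars (\<lambda>_. borel) (\<lambda>i \<omega>. cis (u $ i) ^ sample_path (M i) \<omega> (real a)) UNIV"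
    by (rule indep_vars_compose2[OF indep_M, where Y = "\<lambda>i v. cis (u $ i) ^ v (real a)"]) measurable
  then have indep: "indep_vars (\<lambda>_. borel) (\<lambda>i \<omega>. cis (u $ i) ^ M i (real a) \<omega>) UNIV"
    by simp
  have "(LINT \<omega>|P. (\<Prod>i\<in>UNIV. cis (u $ i) ^ M i (real a) \<omega>)) =
      (\<Prod>i\<in>UNIV. (LINT \<omega>|P. cis (u $ i) ^ M i (real a) \<omega>))"
    by (rule indep_vars_lebesgue_integral[OF _ indep])
       (auto intro!: integrable_const_bound[where B = 1] simp: norm_power)
  then show ?thesis
    by (simp add: cis_inner_vec_of_nat gcp_pgf[OF M] char_M_power)
qed

lemma char_step_pmf:
  assumes "1 \<le> a"
  shows "measure_pmf.expectation (step_pmf a) (\<lambda>n. cis (u \<bullet> vec_of_nat n)) = char_M u ^ a"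
proof -
  have "measure_pmf.expectation (step_pmf a) (\<lambda>n. \<Prod>i\<in>UNIV. cis (u $ i) ^ n i) =
      (\<Prod>i\<in>UNIV. measure_pmf.expectation (gcp_pmf (k i) (lam i) (real a)) (\<lambda>n. cis (u $ i) ^ n))"
    unfolding step_pmf_def
    by (rule expectation_prod_Pi_pmf_bounded[where B = "\<lambda>_. 1"]) (auto simp: norm_power)
  also have "\<dots> = char_M u ^ a"
    unfolding char_M_power
    by (intro prod.cong refl pgf_gcp_pmf) (use assms gcp_rate_pos[OF M] in auto)
  finally show ?thesis by (simp only: cis_inner_vec_of_nat)
qed

text \<open>With \<open>M0\<close> frozen, the inner expectation is \<open>char_M u ^ M0 t\<close>;
  the outer one is then the generating function of \<open>M0 t\<close> at
  \<open>char_M u\<close>.\<close>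

lemma char_igcp:
  assumes "0 \<le> t"
  shows "(LINT \<omega>|P. cis (u \<bullet> multivariate_igcp M0 M t \<omega>)) =
    exp (of_real t * (\<Sum>j=1..k0. of_real (mu j) * (char_M u ^ j - 1)))"
proof -
  let ?f = "\<lambda>z. cis (\<Sum>i\<in>UNIV. u $ i * real (snd z i (real (fst z t))))"
  have "(\<lambda>z. real (snd z i (real (fst z t)))) \<in>
      borel_measurable (path_space \<Otimes>\<^sub>M PiM UNIV (\<lambda>_. path_space))" for i :: 'q
    by (rule measurable_compose[OF measurable_subordinated_path[OF assms]]) simp
  then have f: "?f \<in> borel_measurable (path_space \<Otimes>\<^sub>M PiM UNIV (\<lambda>_. path_space))"
    by (intro measurable_compose[OF _ borel_measurable_cis] borel_measurable_sum
          borel_measurable_times borel_measurable_const)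
  have "(LINT \<omega>|P. cis (u \<bullet> multivariate_igcp M0 M t \<omega>)) = (LINT \<omega>|P. ?f (sample_path M0 \<omega>, paths \<omega>))"
    using assms by (simp add: multivariate_igcp_def inner_vec_def)
  also have "\<dots> = (LINT \<omega>|P. LINT \<omega>'|P. ?f (sample_path M0 \<omega>, paths \<omega>'))"
    by (rule path_integral[where B = 1, OF f]) simp
  also have "\<dots> = (LINT \<omega>|P. LINT \<omega>'|P. cis (u \<bullet> vec_of_nat (\<lambda>i. M i (real (M0 t \<omega>)) \<omega>')))"
    using assms by (simp add: inner_vec_def)
  also have "\<dots> = (LINT \<omega>|P. char_M u ^ M0 t \<omega>)"
    by (simp only: char_M_eq)
  also have "\<dots> = exp (- of_real t * (\<Sum>j=1..k0. of_real (mu j) * (1 - char_M u ^ j)))"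
    by (rule gcp_pgf[OF M0 assms norm_char_M_le])
  also have "- of_real t * (\<Sum>j=1..k0. of_real (mu j) * (1 - char_M u ^ j)) =
      of_real t * (\<Sum>j=1..k0. of_real (mu j) * (char_M u ^ j - 1))"
    by (simp add: sum_distrib_left algebra_simps)
  finally show ?thesis .
qed

text \<open>A jump of \<open>M0\<close> of size \<open>j\<close> has rate \<open>mu j\<close> and
  moves the subordinated process by a vector with law \<open>step_pmf j\<close>. A vanishing move is
  no jump, hence the exception at the origin.\<close>

definition levy_weight :: "('q \<Rightarrow> nat) \<Rightarrow> real" where
  "levy_weight n = (if n = (\<lambda>_. 0) then 0 else \<Sum>j=1..k0. mu j * pmf (step_pmf j) n)"

definition igcp_levy_measure :: "(real ^ 'q) measure" where
  "igcp_levy_measure = distr (density (count_space UNIV) (\<lambda>n. ennreal (levy_weight n))) borel vec_of_nat"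

lemma mu_nonneg: "j \<in> {1..k0} \<Longrightarrow> 0 \<le> mu j"
  using gcp_rate_pos[OF M0, of j] by simp

lemma levy_weight_nonneg: "0 \<le> levy_weight n"
  by (auto simp: levy_weight_def intro!: sum_nonneg mult_nonneg_nonneg mu_nonneg)

lemma sets_igcp_levy_measure: "sets igcp_levy_measure = sets borel"
  by (simp add: igcp_levy_measure_def)

lemma emeasure_igcp_levy_measure:
  assumes "B \<in> sets borel"
  shows "emeasure igcp_levy_measure B =
    (\<Sum>j=1..k0. ennreal (mu j) * emeasure (step_pmf j) {n. n \<noteq> (\<lambda>_. 0) \<and> vec_of_nat n \<in> B})"
proof -
  let ?S = "{n. n \<noteq> (\<lambda>_. 0) \<and> vec_of_nat n \<in> B}"
  have "emeasure igcp_levy_measure B =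
      (\<integral>\<^sup>+ n. ennreal (levy_weight n) * indicator {n. vec_of_nat n \<in> B} n \<partial>count_space UNIV)"
    using assms by (simp add: igcp_levy_measure_def emeasure_distr emeasure_density vimage_def)
  also have "\<dots> = (\<integral>\<^sup>+ n. (\<Sum>j=1..k0. ennreal (mu j) * (ennreal (pmf (step_pmf j) n) * indicator ?S n)) \<partial>count_space UNIV)"
  proof (rule nn_integral_cong)
    fix n :: "'q \<Rightarrow> nat"
    have "(\<Sum>j=1..k0. ennreal (mu j) * ennreal (pmf (step_pmf j) n)) =
        (\<Sum>j=1..k0. ennreal (mu j * pmf (step_pmf j) n))"
      by (intro sum.cong refl ennreal_mult[symmetric] mu_nonneg) auto
    also have "\<dots> = ennreal (\<Sum>j=1..k0. mu j * pmf (step_pmf j) n)"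
      by (intro sum_ennreal mult_nonneg_nonneg mu_nonneg) auto
    finally show "ennreal (levy_weight n) * indicator {n. vec_of_nat n \<in> B} n =
        (\<Sum>j=1..k0. ennreal (mu j) * (ennreal (pmf (step_pmf j) n) * indicator ?S n))"
      by (simp add: levy_weight_def indicator_def)
  qed
  also have "\<dots> = (\<Sum>j=1..k0. ennreal (mu j) * (\<integral>\<^sup>+ n. ennreal (pmf (step_pmf j) n) * indicator ?S n \<partial>count_space UNIV))"
    by (simp add: nn_integral_sum nn_integral_cmult)
  also have "\<dots> = (\<Sum>j=1..k0. ennreal (mu j) * emeasure (step_pmf j) ?S)"
    by (simp add: measure_pmf_eq_density emeasure_density)
  finally show ?thesis .
qed

lemma finite_igcp_levy_measure: "finite_measure igcp_levy_measure"
proof (rule finite_measureI)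
  have "emeasure igcp_levy_measure (space igcp_levy_measure) < \<infinity>"
    by (subst emeasure_igcp_levy_measure)
       (auto simp: igcp_levy_measure_def measure_pmf.emeasure_eq_measure simp flip: ennreal_mult'')
  then show "emeasure igcp_levy_measure (space igcp_levy_measure) \<noteq> \<infinity>" by simp
qed

lemma igcp_levy_measure_zero: "emeasure igcp_levy_measure {0} = 0"
proof -
  have empty: "{n. n \<noteq> (\<lambda>_. 0) \<and> vec_of_nat n \<in> {0}} = ({} :: ('q \<Rightarrow> nat) set)"
    by (auto simp: vec_eq_iff)
  show ?thesis by (subst emeasure_igcp_levy_measure) (simp_all only: empty emeasure_empty, simp_all)
qed

lemma AE_igcp_levy_measure_lattice: "AE x in igcp_levy_measure. \<forall>i. x $ i \<in> \<int>"
proof -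
  have [measurable]: "\<int> \<in> sets (borel :: real measure)"
    by (rule sets.countable) (auto simp: Ints_def)
  have "{x :: real ^ 'q. \<forall>i. x $ i \<in> \<int>} \<in> sets borel" by measurable
  then show ?thesis
    unfolding igcp_levy_measure_def by (subst AE_distr_iff) auto
qed

text \<open>The condition \<open>f 0 = 0\<close> makes up for the mass removed at the origin, so
  that the full laws \<open>step_pmf j\<close> appear on the right.\<close>

lemma integral_igcp_levy_measure:
  fixes f :: "real ^ 'q \<Rightarrow> complex"
  assumes f [measurable]: "f \<in> borel_measurable borel" and bound: "\<And>x. norm (f x) \<le> B" and "f 0 = 0"
  shows "(LINT x|igcp_levy_measure. f x) =
    (\<Sum>j=1..k0. of_real (mu j) * measure_pmf.expectation (step_pmf j) (\<lambda>n. f (vec_of_nat n)))"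
proof -
  have int: "integrable (count_space UNIV) (\<lambda>n. pmf (step_pmf j) n *\<^sub>R f (vec_of_nat n))" for j
    using integrable_pmf_bounded[of "\<lambda>n. f (vec_of_nat n)" B "step_pmf j"] bound
    by (simp add: measure_pmf_eq_density integrable_density)
  have zero: "(\<chi> i. 0) = (0 :: real ^ 'q)" by (simp add: vec_eq_iff)
  have "(LINT x|igcp_levy_measure. f x) = (LINT n|count_space UNIV. levy_weight n *\<^sub>R f (vec_of_nat n))"
    unfolding igcp_levy_measure_def
    by (subst integral_distr) (auto simp: integral_density levy_weight_nonneg)
  also have "\<dots> = (LINT n|count_space UNIV. (\<Sum>j=1..k0. mu j *\<^sub>R (pmf (step_pmf j) n *\<^sub>R f (vec_of_nat n))))"
    by (intro Bochner_Integration.integral_cong refl)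
       (auto simp: levy_weight_def zero \<open>f 0 = 0\<close> scaleR_sum_left)
  also have "\<dots> = (\<Sum>j=1..k0. mu j *\<^sub>R (LINT n|count_space UNIV. pmf (step_pmf j) n *\<^sub>R f (vec_of_nat n)))"
    by (subst Bochner_Integration.integral_sum)
       (intro integrable_scaleR_right int, simp only: integral_scaleR_right)
  also have "\<dots> = (\<Sum>j=1..k0. of_real (mu j) * measure_pmf.expectation (step_pmf j) (\<lambda>n. f (vec_of_nat n)))"
    by (simp add: measure_pmf_eq_density integral_density scaleR_conv_of_real)
  finally show ?thesis .
qed

lemma integral_igcp_levy_measure_cis:
  "(LINT x|igcp_levy_measure. cis (u \<bullet> x) - 1) = (\<Sum>j=1..k0. of_real (mu j) * (char_M u ^ j - 1))"
proof -
  have "norm (cis (u \<bullet> x) - 1) \<le> 2" for x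
    using norm_triangle_ineq4[of "cis (u \<bullet> x)" 1] by simp
  then have "(LINT x|igcp_levy_measure. cis (u \<bullet> x) - 1) =
      (\<Sum>j=1..k0. of_real (mu j) * measure_pmf.expectation (step_pmf j) (\<lambda>n. cis (u \<bullet> vec_of_nat n) - 1))"
    by (intro integral_igcp_levy_measure[where B = 2]) auto
  also have "\<dots> = (\<Sum>j=1..k0. of_real (mu j) * (char_M u ^ j - 1))"
  proof (intro sum.cong refl arg_cong2[where f = "(*)"])
    fix j assume "j \<in> {1..k0}"
    then show "measure_pmf.expectation (step_pmf j) (\<lambda>n. cis (u \<bullet> vec_of_nat n) - 1) = char_M u ^ j - 1"
      by (subst Bochner_Integration.integral_diff)
         (auto simp: char_step_pmf intro!: integrable_pmf_bounded[where B = 1])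
  qed
  finally show ?thesis .
qed

lemma char_igcp_levy_measure:
  "0 \<le> t \<Longrightarrow> (LINT \<omega>|P. cis (u \<bullet> multivariate_igcp M0 M t \<omega>)) =
    exp (of_real t * (LINT x|igcp_levy_measure. cis (u \<bullet> x) - 1))"
  by (simp add: char_igcp integral_igcp_levy_measure_cis)

lemma is_levy_measure_igcp: "is_levy_measure P (multivariate_igcp M0 M) igcp_levy_measure"
  unfolding is_levy_measure_def
proof (intro conjI exI allI impI)
  let ?\<nu> = igcp_levy_measure
  show "levy_process P (multivariate_igcp M0 M)" by (rule levy_process_igcp)
  show "sets ?\<nu> = sets borel" by (rule sets_igcp_levy_measure)
  show "emeasure ?\<nu> {0} = 0" by (rule igcp_levy_measure_zero)
  have "(\<integral>\<^sup>+ x. ennreal (min 1 ((norm x)\<^sup>2)) \<partial>?\<nu>) \<le> (\<integral>\<^sup>+ x. 1 \<partial>?\<nu>)"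
    by (intro nn_integral_mono) (simp add: ennreal_le_1)
  also have "\<dots> < \<infinity>"
    using finite_measure.emeasure_finite[OF finite_igcp_levy_measure] by (simp add: less_top)
  finally show "(\<integral>\<^sup>+ x. ennreal (min 1 ((norm x)\<^sup>2)) \<partial>?\<nu>) < \<infinity>" .
  show "transpose (0 :: real ^ 'q ^ 'q) = 0"
    by (simp add: transpose_def vec_eq_iff)
  fix u :: "real ^ 'q"
  show "0 \<le> u \<bullet> (0 *v u)" by simp
  fix t :: real assume "0 \<le> t"
  \<comment> \<open>The drift is the integral of the small jumps, chosen to cancel the compensator
    and to leave the compound Poisson exponent.\<close>
  then show "(LINT \<omega>|P. cis (u \<bullet> multivariate_igcp M0 M t \<omega>)) = exp (of_real t *
      levy_khintchine_exponent (LINT x|?\<nu>. indicator (cball 0 1) x *\<^sub>R x) 0 ?\<nu> u)"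
    by (simp add: char_igcp_levy_measure
        levy_khintchine_exponent_finite[OF finite_igcp_levy_measure sets_igcp_levy_measure])
qed

text \<open>Any two triplets give the same characteristic functions at all times, so by
  \<open>exp_of_real_mult_eqD\<close> the exponents agree, and
  \<open>levy_measure_lattice_unique\<close> identifies the measures.\<close>

lemma levy_measure_igcp_unique:
  assumes "is_levy_measure P (multivariate_igcp M0 M) \<nu>"
  shows "\<nu> = igcp_levy_measure"
proof -
  from assms obtain b A where \<nu>: "sets \<nu> = sets borel" "emeasure \<nu> {0} = 0"
      "(\<integral>\<^sup>+ x. ennreal (min 1 ((norm x)\<^sup>2)) \<partial>\<nu>) < \<infinity>" "transpose A = A" "\<And>u. 0 \<le> u \<bullet> (A *v u)"
    and char: "\<And>t u. 0 \<le> t \<Longrightarrow> (LINT \<omega>|P. cis (u \<bullet> multivariate_igcp M0 M t \<omega>)) =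
        exp (of_real t * levy_khintchine_exponent b A \<nu> u)"
    unfolding is_levy_measure_def by blast
  show ?thesis
  proof (rule levy_measure_lattice_unique[OF \<nu> finite_igcp_levy_measure sets_igcp_levy_measure
        AE_igcp_levy_measure_lattice igcp_levy_measure_zero])
    show "levy_khintchine_exponent b A \<nu> u = (LINT x|igcp_levy_measure. cis (u \<bullet> x) - 1)" for u
      by (rule exp_of_real_mult_eqD) (simp flip: char char_igcp_levy_measure)
  qed
qed

text \<open>The coordinates are independent, and the product of the finite sums over
  \<open>Omega\<close> expands into one sum over all joint choices.\<close>

lemma pmf_step_pmf:
  assumes "1 \<le> a"
  shows "pmf (step_pmf a) n = (\<Sum>m\<in>(\<Pi>\<^sub>E i\<in>UNIV. Omega (k i) (n i)).
    \<Prod>i\<in>UNIV. \<Prod>j=1..k i. (real a * lam i j) ^ m i j / fact (m i j) * exp (- (real a * lam i j)))"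
proof -
  have "pmf (step_pmf a) n = (\<Prod>i\<in>UNIV. pmf (gcp_pmf (k i) (lam i) (real a)) (n i))"
    unfolding step_pmf_def by (rule pmf_Pi') auto
  also have "\<dots> = (\<Prod>i\<in>UNIV. \<Sum>m\<in>Omega (k i) (n i).
      \<Prod>j=1..k i. (real a * lam i j) ^ m j / fact (m j) * exp (- (real a * lam i j)))"
    by (intro prod.cong refl pmf_gcp_pmf) (use assms gcp_rate_pos[OF M] in auto)
  also have "\<dots> = (\<Sum>m\<in>(\<Pi>\<^sub>E i\<in>UNIV. Omega (k i) (n i)).
      \<Prod>i\<in>UNIV. \<Prod>j=1..k i. (real a * lam i j) ^ m i j / fact (m i j) * exp (- (real a * lam i j)))"
    by (rule prod_sum_PiE) (auto simp: finite_Omega)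
  finally show ?thesis .
qed

lemma igcp_levy_measure_rectangle:
  assumes A: "\<And>i. A i \<in> sets borel"
  shows "emeasure igcp_levy_measure {x. \<forall>i. x $ i \<in> A i} =
    (\<Sum>j0=1..k0. ennreal (mu j0) * (\<Sum>\<^sub>\<infinity>n\<in>{n. n \<noteq> (\<lambda>_. 0)}. \<Sum>m\<in>(\<Pi>\<^sub>E i\<in>UNIV. Omega (k i) (n i)).
      ennreal (\<Prod>i\<in>UNIV.
        (\<Prod>j=1..k i. (real j0 * lam i j) ^ m i j / fact (m i j) * exp (- (real j0 * lam i j)))
        * indicator (A i) (real (n i)))))"
proof -
  let ?w = "\<lambda>j0 m i. \<Prod>j=1..k i. (real j0 * lam i j) ^ m i j / fact (m i j) * exp (- (real j0 * lam i j))"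
  have "{x :: real ^ 'q. \<forall>i. x $ i \<in> A i} \<in> sets borel"
    using A by measurable
  then have "emeasure igcp_levy_measure {x. \<forall>i. x $ i \<in> A i} =
      (\<Sum>j0=1..k0. ennreal (mu j0) * emeasure (step_pmf j0) {n. n \<noteq> (\<lambda>_. 0) \<and> (\<forall>i. real (n i) \<in> A i)})"
    by (simp add: emeasure_igcp_levy_measure)
  also have "\<dots> = (\<Sum>j0=1..k0. ennreal (mu j0) * (\<Sum>\<^sub>\<infinity>n\<in>{n. n \<noteq> (\<lambda>_. 0)}.
      \<Sum>m\<in>(\<Pi>\<^sub>E i\<in>UNIV. Omega (k i) (n i)). ennreal (\<Prod>i\<in>UNIV. ?w j0 m i * indicator (A i) (real (n i)))))"
  proof (intro sum.cong refl arg_cong2[where f = "(*)"])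
    fix j0 assume j0: "j0 \<in> {1..k0}"
    have w: "0 \<le> ?w j0 m i" for m i
      using gcp_rate_pos[OF M] by (intro prod_nonneg mult_nonneg_nonneg divide_nonneg_nonneg zero_le_power) (auto intro: less_imp_le)
    \<comment> \<open>If every coordinate lies in its set, the indicators are 1 and the inner sum is
      a point probability of \<open>step_pmf j0\<close>; otherwise a zero factor kills every
      summand.\<close>
    have sum_eq: "(\<Sum>m\<in>(\<Pi>\<^sub>E i\<in>UNIV. Omega (k i) (n i)). ennreal (\<Prod>i\<in>UNIV. ?w j0 m i * indicator (A i) (real (n i)))) =
        (if \<forall>i. real (n i) \<in> A i then ennreal (pmf (step_pmf j0) n) else 0)" for n
    proof (cases "\<forall>i. real (n i) \<in> A i")
      case True
      have "(\<Sum>m\<in>(\<Pi>\<^sub>E i\<in>UNIV. Omega (k i) (n i)). ennreal (\<Prod>i\<in>UNIV. ?w j0 m i)) =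
          ennreal (\<Sum>m\<in>(\<Pi>\<^sub>E i\<in>UNIV. Omega (k i) (n i)). \<Prod>i\<in>UNIV. ?w j0 m i)"
        by (rule sum_ennreal) (intro prod_nonneg ballI w)
      also have "\<dots> = ennreal (pmf (step_pmf j0) n)"
        using j0 by (subst pmf_step_pmf) auto
      finally have "(\<Sum>m\<in>(\<Pi>\<^sub>E i\<in>UNIV. Omega (k i) (n i)). ennreal (\<Prod>i\<in>UNIV. ?w j0 m i)) =
          ennreal (pmf (step_pmf j0) n)" .
      with True show ?thesis by simp
    next
      case False
      then obtain i where i: "real (n i) \<notin> A i" by auto
      have "(\<Prod>i\<in>UNIV. ?w j0 m i * indicator (A i) (real (n i))) = (0 :: real)" for m
        using i by (intro prod_zero bexI[of _ i]) auto
      then show ?thesis by (simp only: False if_False ennreal_0 sum.neutral_const)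
    qed
    show "emeasure (step_pmf j0) {n. n \<noteq> (\<lambda>_. 0) \<and> (\<forall>i. real (n i) \<in> A i)} =
        (\<Sum>\<^sub>\<infinity>n\<in>{n. n \<noteq> (\<lambda>_. 0)}. \<Sum>m\<in>(\<Pi>\<^sub>E i\<in>UNIV. Omega (k i) (n i)).
          ennreal (\<Prod>i\<in>UNIV. ?w j0 m i * indicator (A i) (real (n i))))"
      unfolding emeasure_pmf_eq_infsum sum_eq by (intro infsum_cong_neutral) auto
  qed
  finally show ?thesis .
qed

end

text \<open>Unique existence is part of the claim, which makes it legitimate to speak of the Levy
  measure. Nonzero tuples of naturals encode the relation that governs the outer summation.\<close>

theorem proposition4p4:
  fixes P :: "'w measure"
    and M :: "'q::finite \<Rightarrow> real \<Rightarrow> 'w \<Rightarrow> nat" and k :: "'q \<Rightarrow> nat" and lam :: "'q \<Rightarrow> nat \<Rightarrow> real"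
    and M0 :: "real \<Rightarrow> 'w \<Rightarrow> nat" and k0 :: nat and mu :: "nat \<Rightarrow> real"
  assumes "prob_space P"
    and "\<And>i. generalized_counting_process P (k i) (lam i) (M i)"
    and "generalized_counting_process P k0 mu M0"
    and "prob_space.indep_vars P (\<lambda>_. path_space) (\<lambda>i. sample_path (M i)) UNIV"
    and "prob_space.indep_set P
           (sets (vimage_algebra (space P) (sample_path M0) path_space))
           (sets (vimage_algebra (space P) (\<lambda>\<omega> i. sample_path (M i) \<omega>) (PiM UNIV (\<lambda>_. path_space))))"
  shows "(\<exists>!\<nu>. is_levy_measure P (multivariate_igcp M0 M) \<nu>) \<and>
    (\<forall>\<nu>. is_levy_measure P (multivariate_igcp M0 M) \<nu> \<longrightarrow>
      (\<forall>A :: 'q \<Rightarrow> real set. (\<forall>i. A i \<in> sets borel) \<longrightarrow>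
        emeasure \<nu> {x. \<forall>i. x $ i \<in> A i} =
          (\<Sum>j0=1..k0. ennreal (mu j0) *
            (\<Sum>\<^sub>\<infinity>n\<in>{n :: 'q \<Rightarrow> nat. n \<noteq> (\<lambda>_. 0)}.
              \<Sum>m\<in>(\<Pi>\<^sub>E i\<in>UNIV. Omega (k i) (n i)).
                ennreal (\<Prod>i\<in>UNIV.
                  (\<Prod>j=1..k i. (real j0 * lam i j) ^ m i j / fact (m i j) * exp (- (real j0 * lam i j)))
                  * indicator (A i) (real (n i)))))))"
proof -
  interpret igcp P M k lam M0 k0 mu
    using assms by (simp add: igcp_def igcp_axioms_def)
  show ?thesis
  proof (intro conjI allI impI)
    show "\<exists>!\<nu>. is_levy_measure P (multivariate_igcp M0 M) \<nu>"
      using is_levy_measure_igcp levy_measure_igcp_unique by blast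
  next
    fix \<nu> and A :: "'q \<Rightarrow> real set"
    assume "is_levy_measure P (multivariate_igcp M0 M) \<nu>" and A: "\<forall>i. A i \<in> sets borel"
    from this(1) have "\<nu> = igcp_levy_measure" by (rule levy_measure_igcp_unique)
    then show "emeasure \<nu> {x. \<forall>i. x $ i \<in> A i} =
      (\<Sum>j0=1..k0. ennreal (mu j0) *
        (\<Sum>\<^sub>\<infinity>n\<in>{n :: 'q \<Rightarrow> nat. n \<noteq> (\<lambda>_. 0)}.
          \<Sum>m\<in>(\<Pi>\<^sub>E i\<in>UNIV. Omega (k i) (n i)).
            ennreal (\<Prod>i\<in>UNIV.
              (\<Prod>j=1..k i. (real j0 * lam i j) ^ m i j / fact (m i j) * exp (- (real j0 * lam i j)))
              * indicator (A i) (real (n i)))))"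
      using A by (simp only: igcp_levy_measure_rectangle)
  qed
qed

end
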